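(* Let $\Omega\subsetneq\mathbb{R}^n$ be open, such that $-\Delta d\ge0$ in $\Omega$ in the sense of distributions, and such that $R:=\sup_{x\in\Omega}d(x)<\infty$. For all $u\in C_c^\infty(\Omega)$, all $s\ge1$ and all $\gamma>1$, $$\int_\Omega\frac{|\nabla u|}{d^{s-1}}dx\ \ge\ (s-1)\int_\Omega\frac{|u|}{d^s}dx+\frac{C}{R^{s-1}}\int_\Omega\frac{|u|}{d}X^\gamma\Big(\frac dR\Big)dx$$ holds with a constant $C\ge\gamma-1$.
   Context: $d(x):=\operatorname{dist}(x,\mathbb{R}^n\setminus\Omega)$; $X(t):=(1-\log t)^{-1}$ for $t\in(0,1]$. *)

theory Defs
  imports "HOL-Analysis.Analysis"
begin

fun iter_partial :: "'a::euclidean_space list \<Rightarrow> ('a \<Rightarrow> real) \<Rightarrow> 'a \<Rightarrow> real" where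
  "iter_partial [] f = f"
| "iter_partial (i # is) f = (\<lambda>x. deriv (\<lambda>t. iter_partial is f (x + t *\<^sub>R i)) 0)"

definition smooth_on :: "'a::euclidean_space set \<Rightarrow> ('a \<Rightarrow> real) \<Rightarrow> bool" where
  "smooth_on U f \<longleftrightarrow>
     (\<forall>is. set is \<subseteq> Basis \<longrightarrow>
        continuous_on U (iter_partial is f) \<and>
        (\<forall>x\<in>U. \<forall>i\<in>Basis.
           ((\<lambda>t. iter_partial is f (x + t *\<^sub>R i)) has_real_derivative
              iter_partial (i # is) f x) (at 0)))"

definition tsupport :: "('a::euclidean_space \<Rightarrow> real) \<Rightarrow> 'a set" where
  "tsupport f = closure {x. f x \<noteq> 0}"

text \<open>Test functions C_c^infinity(Omega), extended by zero outside Omega.\<close>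
definition test_fun :: "'a::euclidean_space set \<Rightarrow> ('a \<Rightarrow> real) \<Rightarrow> bool" where
  "test_fun \<Omega> u \<longleftrightarrow> smooth_on UNIV u \<and> compact (tsupport u) \<and> tsupport u \<subseteq> \<Omega>"

definition grad :: "('a::euclidean_space \<Rightarrow> real) \<Rightarrow> 'a \<Rightarrow> 'a" where
  "grad u x = (\<Sum>i\<in>Basis. iter_partial [i] u x *\<^sub>R i)"

definition laplacian :: "('a::euclidean_space \<Rightarrow> real) \<Rightarrow> 'a \<Rightarrow> real" where
  "laplacian u x = (\<Sum>i\<in>Basis. iter_partial [i, i] u x)"

definition bdist :: "'a::euclidean_space set \<Rightarrow> 'a \<Rightarrow> real" where
  "bdist \<Omega> x = infdist x (- \<Omega>)"

definition distr_superharmonic :: "'a::euclidean_space set \<Rightarrow> ('a \<Rightarrow> real) \<Rightarrow> bool" where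
  "distr_superharmonic \<Omega> f \<longleftrightarrow>
     (\<forall>\<phi>. test_fun \<Omega> \<phi> \<longrightarrow> (\<forall>x. \<phi> x \<ge> 0) \<longrightarrow>
        (LINT x:\<Omega>|lebesgue. f x * laplacian \<phi> x) \<le> 0)"

definition Xf :: "real \<Rightarrow> real" where
  "Xf t = 1 / (1 - ln t)"

end

theory Submission
  imports Defs "HOL-Computational_Algebra.Polynomial"
begin

text \<open>
  Let \<open>h(t) = t powr (1 - s) - R powr (1 - s) * X(t/R) powr (\<gamma> - 1)\<close>. On \<open>(0, R]\<close> one has
  \<open>0 \<le> h(t) \<le> t powr (1 - s)\<close>, and since \<open>t X'(t) = X(t)\<^sup>2\<close>, the function \<open>-h'(d)\<close> is exactly the sum of the two weights
  on the right-hand side, with \<open>C = \<gamma> - 1\<close>. As \<open>\<bar>\<nabla>d\<bar> = 1\<close> almost everywhere, testing superharmonicity of \<open>d\<close>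
  with \<open>\<bar>u\<bar> h(d)\<close> gives the claim. To justify this, \<open>d\<close> is replaced by its mollification \<open>D\<close>, which is smooth
  with \<open>\<Delta>D \<le> 0\<close> near the support of \<open>u\<close>, and \<open>\<bar>u\<bar>\<close> by \<open>sqrt (u\<^sup>2 + \<delta>\<^sup>2) - \<delta>\<close>; the limit follows by dominated
  convergence once \<open>\<bar>\<nabla>D\<bar> \<rightarrow> 1\<close> almost everywhere.

  For the latter, \<open>d\<close> is almost everywhere differentiable with a unit gradient: the function
  \<open>(\<bar>x\<bar>\<^sup>2 - d(x)\<^sup>2) / 2\<close> is convex, so its second differences with step \<open>h\<close> are nonnegative, and their integrals
  against a Lipschitz cutoff are \<open>O(h\<^sup>2)\<close>. Divided by \<open>h\<close> they therefore have infimum \<open>0\<close> almost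
  everywhere, which forces the nearest point in the complement to be unique.
\<close>

section \<open>Smooth bump functions\<close>

lemma tendsto_poly_mult_exp_minus:
  fixes p :: "real poly"
  shows "((\<lambda>x. poly p x * exp (- x)) \<longlongrightarrow> 0) at_top"
proof -
  have "((\<lambda>x. \<Sum>i\<le>degree p. coeff p i * (x ^ i / exp x)) \<longlongrightarrow> (\<Sum>i\<le>degree p. coeff p i * 0)) at_top"
    by (intro tendsto_sum tendsto_mult tendsto_const tendsto_power_div_exp_0)
  then show ?thesis
    by (simp add: poly_altdef exp_minus sum_distrib_right divide_inverse mult.assoc)
qed

text \<open>The function exp(-1/t), flat at 0, with a polynomial in 1/t as prefactor. Carrying the
  polynomial as a parameter makes the family closed under differentiation.\<close>

definition flat :: "real poly \<Rightarrow> real \<Rightarrow> real" where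
  "flat p t = (if t > 0 then poly p (1 / t) * exp (- (1 / t)) else 0)"

text \<open>For t > 0 the derivative of p(1/t) exp(-1/t) is t^(-2) (p - p')(1/t) exp(-1/t), whence
  the polynomial X^2 (p - p'). At 0 the exponential beats every power of 1/t.\<close>

lemma flat_has_derivative:
  "(flat p has_real_derivative flat ([:0, 0, 1:] * (p - pderiv p)) t) (at t)"
proof (cases t "0::real" rule: linorder_cases)
  case less
  have "((\<lambda>_. 0) has_real_derivative 0) (at t)" by simp
  then have "(flat p has_real_derivative 0) (at t)"
    by (rule has_field_derivative_transform_within_open[where S = "{..<0}"])
      (use less in \<open>auto simp: flat_def\<close>)
  then show ?thesis using less by (simp add: flat_def)
next
  case greater
  have "((\<lambda>t. poly p (1 / t) * exp (- (1 / t))) has_real_derivative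
      flat ([:0, 0, 1:] * (p - pderiv p)) t) (at t)"
    using greater
    by (auto intro!: derivative_eq_intros poly_DERIV[THEN DERIV_chain2]
        simp: flat_def field_simps power2_eq_square)
  then show ?thesis
    by (rule has_field_derivative_transform_within_open[where S = "{0<..}"])
      (use greater in \<open>auto simp: flat_def\<close>)
next
  case equal
  \<comment> \<open>With y = 1/h the right difference quotient at 0 is y p(y) exp(-y), and
    \<open>pCons 0 p\<close> is the polynomial y p(y).\<close>
  have "((\<lambda>h. poly (pCons 0 p) (inverse h) * exp (- inverse h)) \<longlongrightarrow> 0) (at_right 0)"
    using tendsto_poly_mult_exp_minus filterlim_inverse_at_top_right
    by (rule filterlim_compose)
  then have "((\<lambda>h. (flat p h - flat p 0) / h) \<longlongrightarrow> 0) (at_right 0)"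
    by (rule Lim_transform_eventually)
      (auto simp: flat_def eventually_at_filter field_simps)
  moreover have "((\<lambda>h. (flat p h - flat p 0) / h) \<longlongrightarrow> 0) (at_left 0)"
    by (rule tendsto_eventually) (auto simp: flat_def eventually_at_filter)
  ultimately have "((\<lambda>h. (flat p h - flat p 0) / h) \<longlongrightarrow> 0) (at 0)"
    by (simp add: filterlim_split_at)
  then show ?thesis
    by (simp add: equal has_field_derivative_iff flat_def)
qed

inductive_set bumps :: "(real \<Rightarrow> real) set" where
  prod: "(\<lambda>t. flat p (1 + t) * flat q (1 - t)) \<in> bumps"
| add: "\<lbrakk>f \<in> bumps; g \<in> bumps\<rbrakk> \<Longrightarrow> (\<lambda>t. f t + g t) \<in> bumps"

lemma bumps_derivative:
  assumes "f \<in> bumps"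
  shows "\<exists>g\<in>bumps. \<forall>t. (f has_real_derivative g t) (at t)"
  using assms
proof induction
  case (prod p q)
  define D :: "real poly \<Rightarrow> real poly" where "D p = [:0, 0, 1:] * (p - pderiv p)" for p
  \<comment> \<open>The inner derivative of 1 - t is -1; this sign is absorbed into the
    polynomial.\<close>
  have flat_minus: "flat (- r) t = - flat r t" for r t
    by (simp add: flat_def)
  have "((\<lambda>t. flat p (1 + t) * flat q (1 - t)) has_real_derivative
      flat (D p) (1 + t) * flat q (1 - t) + flat p (1 + t) * flat (- D q) (1 - t)) (at t)" for t
    unfolding D_def flat_minus
    by (auto intro!: derivative_eq_intros flat_has_derivative[THEN DERIV_chain2])
  then show ?case
    by (intro bexI[of _ "\<lambda>t. flat (D p) (1 + t) * flat q (1 - t) + flat p (1 + t) * flat (- D q) (1 - t)"]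
        bumps.intros) auto
next
  case (add f g)
  then obtain f' g' where "f' \<in> bumps" "g' \<in> bumps"
    "\<And>t. (f has_real_derivative f' t) (at t)" "\<And>t. (g has_real_derivative g' t) (at t)"
    by blast
  then show ?case
    by (intro bexI[of _ "\<lambda>t. f' t + g' t"]) (auto intro!: derivative_intros bumps.add)
qed

lemma
  assumes "f \<in> bumps"
  shows bumps_deriv: "deriv f \<in> bumps"
    and bumps_has_deriv: "(f has_real_derivative deriv f t) (at t)"
proof -
  obtain g where g: "g \<in> bumps" "\<And>t. (f has_real_derivative g t) (at t)"
    using bumps_derivative[OF assms] by blast
  then have "deriv f = g"
    by (auto intro!: DERIV_imp_deriv)
  with g show "deriv f \<in> bumps" "(f has_real_derivative deriv f t) (at t)" by auto
qed

lemma bumps_iter_deriv: "f \<in> bumps \<Longrightarrow> (deriv ^^ n) f \<in> bumps"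
  by (induction n) (auto intro: bumps_deriv)

lemma bumps_continuous: "f \<in> bumps \<Longrightarrow> continuous_on S f"
  by (meson DERIV_isCont bumps_has_deriv continuous_at_imp_continuous_on)

lemma exists_bump:
  obtains f :: "real \<Rightarrow> real" where "f \<in> bumps" "\<And>t. f t \<ge> 0" "f 0 > 0" "\<And>t. \<bar>t\<bar> \<ge> 1 \<Longrightarrow> f t = 0"
proof
  show "(\<lambda>t. flat 1 (1 + t) * flat 1 (1 - t)) \<in> bumps" by (rule bumps.prod)
qed (auto simp: flat_def)

text \<open>A partial derivative along \<open>b\<close> hits only the factor in the coordinate
  \<open>b\<close>, so only the multiplicities of the directions count. Differentiability is proved
  alongside because \<open>iter_partial\<close> is built from \<open>deriv\<close>, whose value is
  determined only where a derivative exists.\<close>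

lemma iter_partial_prod_bumps:
  fixes x :: "'a::euclidean_space"
  assumes "f \<in> bumps" "set is \<subseteq> Basis"
  shows "iter_partial is (\<lambda>x. \<Prod>b\<in>Basis. f (x \<bullet> b)) =
    (\<lambda>x::'a. \<Prod>b\<in>Basis. (deriv ^^ count_list is b) f (x \<bullet> b))"
    and "i \<in> Basis \<Longrightarrow> ((\<lambda>t. iter_partial is (\<lambda>x::'a. \<Prod>b\<in>Basis. f (x \<bullet> b)) (x + t *\<^sub>R i))
      has_real_derivative iter_partial (i # is) (\<lambda>x. \<Prod>b\<in>Basis. f (x \<bullet> b)) x) (at 0)"
proof -
  define P where "P is x = (\<Prod>b\<in>Basis. (deriv ^^ count_list is b) f (x \<bullet> b))" for "is" and x :: 'a
  have D: "((\<lambda>t. P is (x + t *\<^sub>R i)) has_real_derivative P (i # is) x) (at 0)"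
    if i: "i \<in> Basis" for "is" i and x :: 'a
  proof -
    define n where "n = count_list is i"
    define c where "c = (\<Prod>b\<in>Basis - {i}. (deriv ^^ count_list is b) f (x \<bullet> b))"
    have "P is (x + t *\<^sub>R i) = (deriv ^^ n) f (x \<bullet> i + t) * c" for t
      unfolding P_def c_def n_def using i
      by (subst prod.remove[OF finite_Basis i])
        (auto simp: inner_add_left inner_Basis intro!: prod.cong split: if_splits)
    moreover have "P (i # is) x = (deriv ^^ Suc n) f (x \<bullet> i) * c"
      unfolding P_def c_def n_def using i
      by (subst prod.remove[OF finite_Basis i]) (auto intro!: prod.cong split: if_splits)
    moreover have "((\<lambda>t. (deriv ^^ n) f (x \<bullet> i + t)) has_real_derivative (deriv ^^ Suc n) f (x \<bullet> i) * 1) (at 0)"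
      using bumps_has_deriv[OF bumps_iter_deriv[OF assms(1)], of n "x \<bullet> i + 0"]
      by (intro DERIV_chain2[where g = "\<lambda>t. x \<bullet> i + t"]) (auto intro!: derivative_eq_intros)
    ultimately show ?thesis
      by (auto intro!: derivative_eq_intros)
  qed
  have E: "set is \<subseteq> Basis \<Longrightarrow> iter_partial is (\<lambda>x::'a. \<Prod>b\<in>Basis. f (x \<bullet> b)) = P is" for "is"
  proof (induction "is")
    case Nil
    then show ?case by (simp add: P_def fun_eq_iff)
  next
    case (Cons i "is")
    then show ?case using D[of i "is"] by (auto simp: fun_eq_iff intro!: DERIV_imp_deriv)
  qed
  show "iter_partial is (\<lambda>x. \<Prod>b\<in>Basis. f (x \<bullet> b)) =
    (\<lambda>x::'a. \<Prod>b\<in>Basis. (deriv ^^ count_list is b) f (x \<bullet> b))"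
    using E[OF assms(2)] by (simp add: P_def fun_eq_iff)
  show "((\<lambda>t. iter_partial is (\<lambda>x::'a. \<Prod>b\<in>Basis. f (x \<bullet> b)) (x + t *\<^sub>R i))
      has_real_derivative iter_partial (i # is) (\<lambda>x. \<Prod>b\<in>Basis. f (x \<bullet> b)) x) (at 0)"
    if "i \<in> Basis"
    using D[OF that, of "is" x] E[of "i # is"] E[of "is"] that assms(2) by (simp del: iter_partial.simps)
qed

lemma smooth_on_prod_bumps:
  assumes "f \<in> bumps"
  shows "smooth_on UNIV (\<lambda>x::'a::euclidean_space. \<Prod>b\<in>Basis. f (x \<bullet> b))"
  unfolding smooth_on_def
proof (intro allI impI conjI ballI)
  fix "is" :: "'a list" assume "set is \<subseteq> Basis"
  show "continuous_on UNIV (iter_partial is (\<lambda>x::'a. \<Prod>b\<in>Basis. f (x \<bullet> b)))"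
    unfolding iter_partial_prod_bumps(1)[OF assms \<open>set is \<subseteq> Basis\<close>]
    by (intro continuous_on_prod continuous_on_compose2[OF bumps_continuous[OF bumps_iter_deriv[OF assms], of UNIV]]
        continuous_intros) auto
qed (rule iter_partial_prod_bumps(2)[OF assms])

text \<open>Chain rule: each derivative contributes one factor \<open>c\<close>. It serves to
  rescale and normalise mollifiers and, with \<open>c = -1\<close>, to reflect a kernel into y ->
  k(x - y).\<close>

lemma iter_partial_affine:
  fixes f :: "'a::euclidean_space \<Rightarrow> real"
  assumes "smooth_on UNIV f" "set is \<subseteq> Basis"
  shows "iter_partial is (\<lambda>x. b * f (a + c *\<^sub>R x)) = (\<lambda>x. b * c ^ length is * iter_partial is f (a + c *\<^sub>R x))"
    and "i \<in> Basis \<Longrightarrow> ((\<lambda>t. iter_partial is (\<lambda>x. b * f (a + c *\<^sub>R x)) (x + t *\<^sub>R i))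
      has_real_derivative iter_partial (i # is) (\<lambda>x. b * f (a + c *\<^sub>R x)) x) (at 0)"
proof -
  define P where "P is x = b * c ^ length is * iter_partial is f (a + c *\<^sub>R x)" for "is" x
  have D: "((\<lambda>t. P is (x + t *\<^sub>R i)) has_real_derivative P (i # is) x) (at 0)"
    if "i \<in> Basis" "set is \<subseteq> Basis" for "is" i x
  proof -
    have "((\<lambda>t. iter_partial is f (a + c *\<^sub>R x + t *\<^sub>R i)) has_real_derivative
        iter_partial (i # is) f (a + c *\<^sub>R x)) (at (c * 0))"
      using assms(1) that by (simp add: smooth_on_def)
    then have "((\<lambda>t. iter_partial is f (a + c *\<^sub>R x + (c * t) *\<^sub>R i)) has_real_derivative
        iter_partial (i # is) f (a + c *\<^sub>R x) * c) (at 0)"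
      by (rule DERIV_chain2) (auto intro!: derivative_eq_intros)
    then have "((\<lambda>t. b * c ^ length is * iter_partial is f (a + c *\<^sub>R x + (c * t) *\<^sub>R i)) has_real_derivative
        b * c ^ length is * (iter_partial (i # is) f (a + c *\<^sub>R x) * c)) (at 0)"
      by (rule DERIV_cmult)
    then show ?thesis
      by (simp add: P_def algebra_simps del: iter_partial.simps)
  qed
  have E: "set is \<subseteq> Basis \<Longrightarrow> iter_partial is (\<lambda>x. b * f (a + c *\<^sub>R x)) = P is" for "is"
  proof (induction "is")
    case Nil
    then show ?case by (simp add: P_def fun_eq_iff)
  next
    case (Cons i "is")
    then show ?case using D[of i "is"] by (auto simp: fun_eq_iff intro!: DERIV_imp_deriv)
  qed
  show "iter_partial is (\<lambda>x. b * f (a + c *\<^sub>R x)) = (\<lambda>x. b * c ^ length is * iter_partial is f (a + c *\<^sub>R x))"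
    using E[OF assms(2)] by (simp add: P_def fun_eq_iff)
  show "((\<lambda>t. iter_partial is (\<lambda>x. b * f (a + c *\<^sub>R x)) (x + t *\<^sub>R i))
      has_real_derivative iter_partial (i # is) (\<lambda>x. b * f (a + c *\<^sub>R x)) x) (at 0)"
    if "i \<in> Basis"
    using D[OF that assms(2), of x] E[of "i # is"] E[of "is"] that assms(2) by (simp del: iter_partial.simps)
qed

lemma smooth_on_affine:
  fixes f :: "'a::euclidean_space \<Rightarrow> real"
  assumes "smooth_on UNIV f"
  shows "smooth_on UNIV (\<lambda>x. b * f (a + c *\<^sub>R x))"
  unfolding smooth_on_def
proof (intro allI impI conjI ballI)
  fix "is" :: "'a list" assume "set is \<subseteq> Basis"
  moreover from this assms have "continuous_on UNIV (iter_partial is f)"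
    by (auto simp: smooth_on_def)
  ultimately show "continuous_on UNIV (iter_partial is (\<lambda>x. b * f (a + c *\<^sub>R x)))"
    unfolding iter_partial_affine(1)[OF assms \<open>set is \<subseteq> Basis\<close>]
    by (intro continuous_intros continuous_on_compose2[where f = "\<lambda>x. a + c *\<^sub>R x"]) auto
qed (rule iter_partial_affine(2)[OF assms])

section \<open>Convolution and partial derivatives\<close>

lemma integral_tendsto_compact_support:
  fixes g :: "nat \<Rightarrow> 'a::euclidean_space \<Rightarrow> real"
  assumes "compact K" and [measurable]: "\<And>n. g n \<in> borel_measurable lborel" "g' \<in> borel_measurable lborel"
    and lim: "AE y in lborel. (\<lambda>n. g n y) \<longlonglongrightarrow> g' y"
    and bound: "\<And>n y. y \<in> K \<Longrightarrow> \<bar>g n y\<bar> \<le> M" and support: "\<And>n y. y \<notin> K \<Longrightarrow> g n y = 0"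
  shows "(\<lambda>n. LINT y|lborel. g n y) \<longlonglongrightarrow> (LINT y|lborel. g' y)"
proof (rule integral_dominated_convergence)
  show "integrable lborel (\<lambda>y. indicator K y *\<^sub>R M)"
    using assms(1) by (intro borel_integrable_compact continuous_intros)
  show "AE y in lborel. norm (g n y) \<le> indicator K y *\<^sub>R M" for n
    using bound support by (auto simp: indicator_def)
qed (use lim in auto)

lemma integrable_compact_support:
  fixes f :: "'a::euclidean_space \<Rightarrow> real"
  assumes "compact K" "continuous_on K f" "\<And>x. x \<notin> K \<Longrightarrow> f x = 0"
  shows "integrable lborel f"
proof -
  have "(\<lambda>x. indicator K x *\<^sub>R f x) = f"
    using assms(3) by (auto simp: indicator_def fun_eq_iff)
  then show ?thesis
    using borel_integrable_compact[OF assms(1,2)] by simp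
qed

lemma bounded_compact_support:
  fixes f :: "'a::euclidean_space \<Rightarrow> real"
  assumes "compact K" "continuous_on K f" "\<And>x. x \<notin> K \<Longrightarrow> f x = 0"
  obtains M where "M > 0" "\<And>x. \<bar>f x\<bar> \<le> M"
proof -
  have "bounded (f ` K)"
    using assms by (intro compact_imp_bounded compact_continuous_image)
  then obtain M where "M > 0" "\<And>x. x \<in> K \<Longrightarrow> \<bar>f x\<bar> \<le> M"
    by (auto simp: bounded_pos)
  with assms(3) show ?thesis
    by (metis abs_zero less_eq_real_def that)
qed

lemma lborel_integral_affine:
  fixes f :: "'a::euclidean_space \<Rightarrow> real"
  assumes [measurable]: "f \<in> borel_measurable borel" and "c \<noteq> 0"
  shows "(LINT x|lborel. f x) = \<bar>c\<bar> ^ DIM('a) * (LINT x|lborel. f (a + c *\<^sub>R x))"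
proof -
  have "(LINT x|lborel. f x) =
      (LINT x|density (distr lborel borel (\<lambda>x. a + c *\<^sub>R x)) (\<lambda>_. ennreal (\<bar>c\<bar> ^ DIM('a))). f x)"
    using lborel_affine[OF \<open>c \<noteq> 0\<close>, of a] by (simp add: ennreal_power)
  also have "\<dots> = (LINT x|distr lborel borel (\<lambda>x. a + c *\<^sub>R x). \<bar>c\<bar> ^ DIM('a) * f x)"
    by (subst integral_density) auto
  also have "\<dots> = (LINT x|lborel. \<bar>c\<bar> ^ DIM('a) * f (a + c *\<^sub>R x))"
    by (subst integral_distr) auto
  finally show ?thesis by simp
qed

lemma lborel_integral_reflect:
  fixes f :: "'a::euclidean_space \<Rightarrow> real"
  assumes "f \<in> borel_measurable borel"
  shows "(LINT x|lborel. f (a - x)) = (LINT x|lborel. f x)"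
  using lborel_integral_affine[OF assms, of "-1" a] by simp

definition has_partial :: "('a::euclidean_space \<Rightarrow> real) \<Rightarrow> 'a \<Rightarrow> ('a \<Rightarrow> real) \<Rightarrow> bool" where
  "has_partial F i G \<longleftrightarrow> (\<forall>x. ((\<lambda>t. F (x + t *\<^sub>R i)) has_real_derivative G x) (at 0))"

lemma has_partial_line:
  assumes "has_partial F i G"
  shows "((\<lambda>t. F (x + t *\<^sub>R i)) has_real_derivative G (x + t *\<^sub>R i)) (at t)"
proof -
  have "((\<lambda>h. F (x + (t + h) *\<^sub>R i)) has_real_derivative G (x + t *\<^sub>R i)) (at 0)"
    using assms[unfolded has_partial_def, rule_format, of "x + t *\<^sub>R i"]
    by (simp add: scaleR_add_left add.assoc)
  then show ?thesis
    using DERIV_at_within_shift[of "\<lambda>t. F (x + t *\<^sub>R i)" _ t 0 UNIV] by simp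
qed

text \<open>The mean value theorem along a line. It bounds difference quotients uniformly in the
  step, as dominated convergence requires.\<close>

lemma has_partial_diff_bound:
  assumes "has_partial F i G" "\<And>x. \<bar>G x\<bar> \<le> M"
  shows "\<bar>F (x + t *\<^sub>R i) - F x\<bar> \<le> M * \<bar>t\<bar>"
  using field_differentiable_bound[of UNIV "\<lambda>t. F (x + t *\<^sub>R i)" "\<lambda>t. G (x + t *\<^sub>R i)" M t 0]
    has_partial_line[OF assms(1)] assms(2) by simp

definition conv :: "('a::euclidean_space \<Rightarrow> real) \<Rightarrow> ('a \<Rightarrow> real) \<Rightarrow> 'a \<Rightarrow> real" where
  "conv f k x = (LINT y|lborel. f y * k (x - y))"

text \<open>All \<open>g n\<close> live in one ball, on which the continuous \<open>f\<close> is
  bounded, so a constant on that ball is an integrable majorant.\<close>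

lemma conv_tendsto:
  fixes f :: "'a::euclidean_space \<Rightarrow> real"
  assumes f: "continuous_on UNIV f"
    and g: "\<And>n. continuous_on UNIV (g n)" "continuous_on UNIV g'"
    and lim: "\<And>y. (\<lambda>n. g n y) \<longlonglongrightarrow> g' y"
    and bound: "\<And>n y. \<bar>g n y\<bar> \<le> M" and support: "\<And>n y. norm y > r \<Longrightarrow> g n y = 0"
  shows "(\<lambda>n. LINT y|lborel. f y * g n y) \<longlonglongrightarrow> (LINT y|lborel. f y * g' y)"
proof -
  obtain B where B: "\<And>y. y \<in> cball 0 r \<Longrightarrow> \<bar>f y\<bar> \<le> B"
    using compact_imp_bounded[OF compact_continuous_image[OF continuous_on_subset[OF f subset_UNIV] compact_cball[of 0 r]]]
    unfolding bounded_pos by (metis image_eqI real_norm_def)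
  show ?thesis
  proof (rule integral_tendsto_compact_support[where M = "B * M"])
    show "compact (cball 0 r :: 'a set)" by simp
    show "(\<lambda>y. f y * g n y) \<in> borel_measurable lborel" for n
      using f g(1) by (auto intro!: borel_measurable_continuous_onI continuous_intros)
    show "(\<lambda>y. f y * g' y) \<in> borel_measurable lborel"
      using f g(2) by (auto intro!: borel_measurable_continuous_onI continuous_intros)
    show "\<bar>f y * g n y\<bar> \<le> B * M" if "y \<in> cball 0 r" for n y
      unfolding abs_mult using B[OF that] bound[of n y] by (intro mult_mono) auto
  qed (use support lim in \<open>auto intro!: tendsto_mult\<close>)
qed

text \<open>Differentiation under the integral sign: the derivative falls on the kernel. By
  iteration, convolving a merely continuous \<open>f\<close> with a smooth compactly supported
  kernel gives a smooth function.\<close>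

lemma
  fixes f k :: "'a::euclidean_space \<Rightarrow> real"
  assumes f: "continuous_on UNIV f" and k: "continuous_on UNIV k" "\<And>x. norm x > r \<Longrightarrow> k x = 0"
  shows conv_continuous: "continuous_on S (conv f k)"
    and conv_has_partial: "\<lbrakk>continuous_on UNIV k'; \<And>x. norm x > r \<Longrightarrow> k' x = 0; has_partial k i k'; i \<in> Basis\<rbrakk>
      \<Longrightarrow> has_partial (conv f k) i (conv f k')"
proof -
  have "continuous_on UNIV (conv f k)"
    unfolding continuous_on_sequentially conv_def comp_def
  proof (intro allI ballI impI)
    fix x and X :: "nat \<Rightarrow> 'a" assume X: "(\<forall>n. X n \<in> UNIV) \<and> X \<longlonglongrightarrow> x"
    obtain M where M: "M > 0" "\<And>x. \<bar>k x\<bar> \<le> M"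
      using bounded_compact_support[of "cball 0 r" k] k by (auto intro: continuous_on_subset)
    obtain R where R: "\<And>n. norm (X n) \<le> R"
      using X convergent_imp_Bseq[of X] by (auto simp: convergent_def elim!: BseqE)
    show "(\<lambda>n. LINT y|lborel. f y * k (X n - y)) \<longlonglongrightarrow> (LINT y|lborel. f y * k (x - y))"
    proof (rule conv_tendsto[where M = M and r = "r + R"])
      show "(\<lambda>n. k (X n - y)) \<longlonglongrightarrow> k (x - y)" for y
        using X by (intro continuous_on_tendsto_compose[OF k(1)] tendsto_intros) auto
      show "k (X n - y) = 0" if "norm y > r + R" for n y
        using that R[of n] norm_triangle_ineq2[of y "X n"] by (intro k(2)) (simp add: norm_minus_commute)
    qed (use f M in \<open>auto intro!: continuous_intros continuous_on_compose2[OF k(1)]\<close>)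
  qed
  then show "continuous_on S (conv f k)"
    by (rule continuous_on_subset) auto
  assume k': "continuous_on UNIV k'" "\<And>x. norm x > r \<Longrightarrow> k' x = 0"
    and p: "has_partial k i k'" and i: "i \<in> Basis"
  obtain M where M: "M > 0" "\<And>x. \<bar>k' x\<bar> \<le> M"
    using bounded_compact_support[of "cball 0 r" k'] k' by (auto intro: continuous_on_subset)
  have int: "integrable lborel (\<lambda>y. f y * k (x - y))" for x
    by (rule integrable_compact_support[of "cball x r"])
      (auto intro!: continuous_intros continuous_on_compose2[OF k(1)] continuous_on_subset[OF f] k(2) simp: dist_norm)
  show "has_partial (conv f k) i (conv f k')"
    unfolding has_partial_def has_field_derivative_iff tendsto_at_iff_sequentially comp_def
  proof (intro allI impI)
    fix x and X :: "nat \<Rightarrow> real" assume X: "\<forall>n. X n \<in> UNIV - {0}" "X \<longlonglongrightarrow> 0"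
    obtain R where R: "\<And>n. \<bar>X n\<bar> \<le> R"
      using convergent_imp_Bseq[OF convergentI[OF X(2)]] by (metis BseqE real_norm_def)
    have lim: "(\<lambda>n. LINT y|lborel. f y * ((k (x + X n *\<^sub>R i - y) - k (x - y)) / X n))
        \<longlonglongrightarrow> (LINT y|lborel. f y * k' (x - y))"
    \<comment> \<open>The convergent steps \<open>X n\<close> are bounded by \<open>R\<close>, so
      all shifted kernels vanish outside one ball.\<close>
    proof (rule conv_tendsto[where M = M and r = "norm x + r + R"])
      show "(\<lambda>n. (k (x + X n *\<^sub>R i - y) - k (x - y)) / X n) \<longlonglongrightarrow> k' (x - y)" for y
      proof -
        have "((\<lambda>t. (k ((x - y) + t *\<^sub>R i) - k (x - y)) / t) \<longlongrightarrow> k' (x - y)) (at 0)"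
          using p[unfolded has_partial_def, rule_format, of "x - y"] by (simp add: has_field_derivative_iff)
        then show ?thesis
          using X by (auto simp: tendsto_at_iff_sequentially comp_def algebra_simps)
      qed
      show "\<bar>(k (x + X n *\<^sub>R i - y) - k (x - y)) / X n\<bar> \<le> M" for n y
        using has_partial_diff_bound[OF p M(2), of "x - y" "X n"] X
        by (auto simp: field_simps)
      show "(k (x + X n *\<^sub>R i - y) - k (x - y)) / X n = 0" if y: "norm y > norm x + r + R" for n y
      proof -
        have "norm (X n *\<^sub>R i) \<le> R" using R[of n] i by simp
        moreover have "R \<ge> 0" using R[of 0] by linarith
        moreover have "norm (x + v - y) \<ge> norm y - norm x - norm v" for v
          by norm
        from this[of "X n *\<^sub>R i"]
        have "norm (x + X n *\<^sub>R i - y) \<ge> norm y - norm x - norm (X n *\<^sub>R i)" .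
        moreover have "norm (x - y) \<ge> norm y - norm x"
          by norm
        ultimately show ?thesis
          using y k(2)[of "x + X n *\<^sub>R i - y"] k(2)[of "x - y"] by simp
      qed
    qed (use X in \<open>auto intro!: f continuous_intros continuous_on_compose2[OF k(1)] continuous_on_compose2[OF k'(1)]\<close>)
    have quot: "(LINT y|lborel. f y * ((k (x + X n *\<^sub>R i - y) - k (x - y)) / X n)) =
        (conv f k (x + X n *\<^sub>R i) - conv f k x) / X n" for n
    proof -
      have "conv f k (x + X n *\<^sub>R i) - conv f k x =
          (LINT y|lborel. f y * k (x + X n *\<^sub>R i - y) - f y * k (x - y))"
        unfolding conv_def using int by simp
      then show ?thesis
        by (simp add: right_diff_distrib flip: integral_divide_zero)
    qed
    show "(\<lambda>n. (conv f k (x + X n *\<^sub>R i) - conv f k (x + 0 *\<^sub>R i)) / (X n - 0)) \<longlonglongrightarrow> conv f k' x"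
      using lim unfolding quot by (simp add: conv_def[of f k'])
  qed
qed

lemma conv_commute:
  fixes f k :: "'a::euclidean_space \<Rightarrow> real"
  assumes "continuous_on UNIV f" "continuous_on UNIV k"
  shows "conv f k x = (LINT y|lborel. f (x - y) * k y)"
proof -
  have "(\<lambda>y. f (x - y) * k y) \<in> borel_measurable borel"
    using assms
    by (auto intro!: borel_measurable_continuous_onI continuous_intros continuous_on_compose2[OF assms(1)])
  from lborel_integral_reflect[OF this, of x] show ?thesis
    by (simp add: conv_def)
qed

text \<open>Convolving with the constant 1 yields a constant function, whose derivative is the integral below.\<close>

lemma integral_partial_eq_0:
  fixes F G :: "'a::euclidean_space \<Rightarrow> real"
  assumes "continuous_on UNIV F" "continuous_on UNIV G" "has_partial F i G" "i \<in> Basis"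
    and "\<And>x. norm x > r \<Longrightarrow> F x = 0" "\<And>x. norm x > r \<Longrightarrow> G x = 0"
  shows "(LINT x|lborel. G x) = 0"
proof -
  have eq: "conv (\<lambda>_. 1) H = (\<lambda>_. LINT y|lborel. H y)" if "continuous_on UNIV H" for H :: "'a \<Rightarrow> real"
    using conv_commute[of "\<lambda>_. 1" H] that by auto
  have "has_partial (conv (\<lambda>_. 1) F) i (conv (\<lambda>_. 1) G)"
    using assms by (intro conv_has_partial[where r = r]) auto
  then have "((\<lambda>_. LINT y|lborel. F y) has_real_derivative (LINT y|lborel. G y)) (at 0)"
    using assms by (simp add: eq has_partial_def)
  then show ?thesis
    by (metis DERIV_const DERIV_unique)
qed

section \<open>Differentiability of the distance function\<close>

text \<open>The function \<open>Phi A\<close> is the supremum over \<open>p \<in> A\<close> of the affine functions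
  \<open>z \<mapsto> z \<bullet> p - (norm p)\<^sup>2 / 2\<close>, hence convex; the nearest points of \<open>x\<close> in \<open>A\<close> are subgradients at \<open>x\<close>.\<close>

definition Phi :: "'a::euclidean_space set \<Rightarrow> 'a \<Rightarrow> real" where
  "Phi A x = ((norm x)\<^sup>2 - (infdist x A)\<^sup>2) / 2"

definition nearest :: "'a::euclidean_space set \<Rightarrow> 'a \<Rightarrow> 'a \<Rightarrow> bool" where
  "nearest A x p \<longleftrightarrow> p \<in> A \<and> infdist x A = dist x p"

text \<open>Expanding the square, |z|^2 cancels against the one in |z - p|^2. What remains of
  \<open>infdist z A \<le> dist z p\<close>, an equality at z = x, is an affine minorant with slope
  \<open>p\<close>.\<close>

lemma Phi_subgradient:
  assumes "nearest A x p"
  shows "Phi A z \<ge> Phi A x + (z - x) \<bullet> p"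
proof -
  have dist: "(dist y p)\<^sup>2 = (norm y)\<^sup>2 - 2 * (y \<bullet> p) + (norm p)\<^sup>2" for y
    by (simp add: dist_norm power2_norm_eq_inner algebra_simps inner_commute)
  have "(infdist z A)\<^sup>2 \<le> (dist z p)\<^sup>2"
    using assms by (intro power_mono infdist_le infdist_nonneg) (auto simp: nearest_def)
  moreover have "(infdist x A)\<^sup>2 = (dist x p)\<^sup>2"
    using assms by (simp add: nearest_def)
  ultimately show ?thesis
    unfolding Phi_def dist inner_diff_left by argo
qed

lemma nearest_exists:
  assumes "closed A" "A \<noteq> {}"
  obtains p where "nearest A x p"
  using infdist_attains_inf[OF assms, of x] that by (auto simp: nearest_def)

lemma nearest_norm_le: "nearest A x p \<Longrightarrow> norm p \<le> norm x + infdist x A"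
  using norm_triangle_ineq2[of p x] by (simp add: nearest_def dist_norm norm_minus_commute)

lemma continuous_Phi [continuous_intros]: "continuous_on S (Phi A)"
  unfolding Phi_def by (intro continuous_intros continuous_on_infdist) auto

text \<open>The norm and the distance are 1-Lipschitz and bounded on the ball by \<open>r\<close>
  and \<open>r + infdist 0 A\<close>. A difference of squares gains twice these bounds, and the half
  in \<open>Phi\<close> removes the factor 2.\<close>

lemma Phi_lipschitz:
  assumes "norm x \<le> r" "norm z \<le> r"
  shows "\<bar>Phi A z - Phi A x\<bar> \<le> (2 * r + infdist 0 A) * norm (z - x)"
proof -
  have sq: "\<bar>a\<^sup>2 - b\<^sup>2\<bar> \<le> 2 * c * t" if "\<bar>a - b\<bar> \<le> t" "\<bar>a\<bar> \<le> c" "\<bar>b\<bar> \<le> c" for a b c t :: real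
  proof -
    have "\<bar>a\<^sup>2 - b\<^sup>2\<bar> = \<bar>a + b\<bar> * \<bar>a - b\<bar>"
      by (simp add: power2_eq_square flip: abs_mult) (simp add: algebra_simps)
    also have "\<dots> \<le> (2 * c) * t"
      using that by (intro mult_mono) auto
    finally show ?thesis .
  qed
  have inf: "infdist y A \<le> r + infdist 0 A" if "norm y \<le> r" for y
    using infdist_triangle[of y A 0] that by simp
  have 1: "\<bar>(norm z)\<^sup>2 - (norm x)\<^sup>2\<bar> \<le> 2 * r * norm (z - x)"
    using assms by (intro sq norm_triangle_ineq3) auto
  have 2: "\<bar>(infdist z A)\<^sup>2 - (infdist x A)\<^sup>2\<bar> \<le> 2 * (r + infdist 0 A) * norm (z - x)"
    using assms inf infdist_triangle_abs[of z A x] by (intro sq) (auto simp: dist_norm infdist_nonneg)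
  have half: "\<bar>(a - c) / 2 - (b - d) / 2\<bar> \<le> (P + Q) / 2" if "\<bar>a - b\<bar> \<le> P" "\<bar>c - d\<bar> \<le> Q"
    for a b c d P Q :: real
    using that unfolding abs_le_iff by (simp add: field_simps)
  have "\<bar>Phi A z - Phi A x\<bar> \<le>
      (2 * r * norm (z - x) + 2 * (r + infdist 0 A) * norm (z - x)) / 2"
    unfolding Phi_def by (rule half[OF 1 2])
  then show ?thesis
    by (simp add: algebra_simps)
qed

section \<open>Second differences of \<open>Phi\<close> and almost everywhere
  differentiability\<close>

definition secdiff :: "('a::real_vector \<Rightarrow> real) \<Rightarrow> 'a \<Rightarrow> real \<Rightarrow> 'a \<Rightarrow> real" where
  "secdiff f e h x = f (x + h *\<^sub>R e) + f (x - h *\<^sub>R e) - 2 * f x"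

text \<open>The subgradient inequalities at x + h e and x - h e are added; their linear terms
  cancel.\<close>

lemma secdiff_Phi_nonneg:
  assumes "closed A" "A \<noteq> {}"
  shows "secdiff (Phi A) e h x \<ge> 0"
proof -
  obtain p where p: "nearest A x p" using nearest_exists[OF assms] .
  show ?thesis
    using Phi_subgradient[OF p, of "x + h *\<^sub>R e"] Phi_subgradient[OF p, of "x - h *\<^sub>R e"]
    by (simp add: secdiff_def)
qed

text \<open>Summation by parts: one of the two differences in \<open>secdiff\<close> is moved onto
  \<open>w\<close>. The integrand becomes a product of two first differences, each of order
  \<open>h\<close> by Lipschitz continuity.\<close>

lemma integral_secdiff_bound:
  fixes f w :: "'a::euclidean_space \<Rightarrow> real"
  assumes f: "continuous_on UNIV f" and w: "continuous_on UNIV w" "\<And>x. norm x > r \<Longrightarrow> w x = 0"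
    and fL: "\<And>x z. norm x \<le> r + 2 \<Longrightarrow> norm z \<le> r + 2 \<Longrightarrow> \<bar>f z - f x\<bar> \<le> L * norm (z - x)"
    and wL: "\<And>x z. \<bar>w z - w x\<bar> \<le> norm (z - x)"
    and e: "norm e = 1" and h: "0 < h" "h \<le> 1" and L: "L \<ge> 0"
  shows "(LINT x|lborel. w x * secdiff f e h x) \<le> L * measure lborel (cball 0 (r + 1) :: 'a set) * h\<^sup>2"
proof -
  define a where "a = h *\<^sub>R e"
  have na: "norm a = h" using e h by (simp add: a_def)
  have nz: "norm (x + a) > r" "norm (x - a) > r" if "norm x > r + 1" for x
    using that na h norm_triangle_ineq4[of "x + a" a] norm_triangle_ineq[of "x - a" a] by simp_all
  have int: "integrable lborel (\<lambda>x. w (x + b) * (f (x + c) - f (x + d)))" if "b = 0 \<or> b = a" for b c d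
  proof (rule integrable_compact_support[of "cball 0 (r + 1)"])
    show "w (x + b) * (f (x + c) - f (x + d)) = 0" if "x \<notin> cball 0 (r + 1)" for x
      using that \<open>b = 0 \<or> b = a\<close> nz[of x] w(2)[of x] w(2)[of "x + a"] by auto
  qed (auto intro!: continuous_intros continuous_on_compose2[OF f] continuous_on_compose2[OF w(1)])
  \<comment> \<open>Translation by \<open>a\<close> turns the backward difference weighted at x into
    the forward difference weighted at x + a.\<close>
  have "(LINT x|lborel. w (x + 0) * (f (x + 0) - f (x + - a))) = (LINT x|lborel. w (x + a) * (f (x + a) - f (x + 0)))"
    using lborel_integral_affine[of "\<lambda>x. w (x + 0) * (f (x + 0) - f (x + - a))" 1 a] int[of 0 0 "-a"]
    by (simp add: add.commute borel_measurable_integrable)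
  then have "(LINT x|lborel. w x * secdiff f e h x) =
      (LINT x|lborel. w (x + 0) * (f (x + a) - f (x + 0))) - (LINT x|lborel. w (x + a) * (f (x + a) - f (x + 0)))"
    using int[of 0 a 0] int[of 0 0 "-a"]
    by (subst (asm) eq_commute) (simp add: secdiff_def a_def algebra_simps flip: Bochner_Integration.integral_diff)
  also have "\<dots> = (LINT x|lborel. (w x - w (x + a)) * (f (x + a) - f x))"
    using int[of 0 a 0] int[of a a 0]
    by (subst Bochner_Integration.integral_diff[symmetric]) (auto simp: algebra_simps)
  also have "\<dots> \<le> (LINT x::'a|lborel. indicator (cball 0 (r + 1)) x *\<^sub>R (L * h\<^sup>2))"
  proof (rule Bochner_Integration.integral_mono)
    show "integrable lborel (\<lambda>x. (w x - w (x + a)) * (f (x + a) - f x))"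
      using int[of 0 a 0] int[of a a 0] Bochner_Integration.integrable_diff[OF int[of 0 a 0] int[of a a 0]]
      by (simp add: algebra_simps)
    show "integrable lborel (\<lambda>x::'a. indicator (cball 0 (r + 1)) x *\<^sub>R (L * h\<^sup>2))"
      by (intro borel_integrable_compact continuous_intros) auto
    fix x :: 'a
    show "(w x - w (x + a)) * (f (x + a) - f x) \<le> indicator (cball 0 (r + 1)) x *\<^sub>R (L * h\<^sup>2)"
    proof (cases "norm x \<le> r + 1")
      case True
      then have "norm (x + a) \<le> r + 2" using norm_triangle_ineq[of x a] na h by simp
      then have "\<bar>f (x + a) - f x\<bar> \<le> L * h" using fL[of x "x + a"] True na by simp
      moreover have "\<bar>w x - w (x + a)\<bar> \<le> h" using wL[of x "x + a"] na by simp
      ultimately have "\<bar>(w x - w (x + a)) * (f (x + a) - f x)\<bar> \<le> h * (L * h)"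
        unfolding abs_mult using h L by (intro mult_mono) auto
      then show ?thesis using True by (simp add: power2_eq_square mult.left_commute)
    next
      case False
      then show ?thesis using nz[of x] w(2)[of x] w(2)[of "x + a"] by simp
    qed
  qed
  also have "\<dots> = L * measure lborel (cball 0 (r + 1) :: 'a set) * h\<^sup>2"
    by (simp add: mult.commute mult.left_commute)
  finally show ?thesis .
qed

lemma AE_secdiff_Phi:
  fixes A :: "'a::euclidean_space set"
  assumes A: "closed A" "A \<noteq> {}" and e: "norm e = 1"
  shows "AE x in lborel. \<forall>\<epsilon>>0. \<exists>h>0. secdiff (Phi A) e h x < \<epsilon> * h"
proof -
  define H :: "nat \<Rightarrow> real" where "H n = 1 / real (Suc n)" for n
  have H: "0 < H n" "H n \<le> 1" for n by (auto simp: H_def)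
  have "AE x in lborel. norm x < real k \<longrightarrow> (\<forall>\<epsilon>>0. \<exists>h>0. secdiff (Phi A) e h x < \<epsilon> * h)" for k
  proof -
    \<comment> \<open>A 1-Lipschitz cutoff, positive exactly on the open ball of radius
      \<open>k\<close>, so that one can divide by it there; countably many such balls exhaust the
      space.\<close>
    define w where "w x = max 0 (real k - norm x)" for x :: 'a
    define F where "F n x = w x * secdiff (Phi A) e (H n) x / H n" for n x
    define C where "C = (2 * (real k + 2) + infdist 0 A) * measure lborel (cball 0 (real k + 1) :: 'a set)"
    have F0: "F n x \<ge> 0" for n x
      using secdiff_Phi_nonneg[OF A] H[of n] by (auto simp: F_def w_def)
    have contF: "continuous_on UNIV (F n)" for n
      unfolding F_def w_def secdiff_def using H[of n]
      by (intro continuous_intros continuous_on_compose2[OF continuous_Phi[of UNIV]]) auto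
    have [measurable]: "F n \<in> borel_measurable lborel" for n
      using contF by (auto intro: borel_measurable_continuous_onI)
    have intF: "integrable lborel (F n)" for n
    proof (rule integrable_compact_support[of "cball 0 (real k)"])
      show "continuous_on (cball 0 (real k)) (F n)"
        by (rule continuous_on_subset[OF contF]) simp
    qed (auto simp: F_def w_def)
    have bound: "(LINT x|lborel. F n x) \<le> C * H n" for n
    proof -
      have "(LINT x|lborel. w x * secdiff (Phi A) e (H n) x) \<le> C * (H n)\<^sup>2"
        unfolding C_def
      proof (rule integral_secdiff_bound)
        show "\<bar>w z - w x\<bar> \<le> norm (z - x)" for x z
          using norm_triangle_ineq3[of z x] by (auto simp: w_def)
        show "\<bar>Phi A z - Phi A x\<bar> \<le> (2 * (real k + 2) + infdist 0 A) * norm (z - x)"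
          if "norm x \<le> real k + 2" "norm z \<le> real k + 2" for x z
          using that by (rule Phi_lipschitz)
      qed (use H[of n] e in \<open>auto simp: w_def infdist_nonneg intro!: continuous_intros\<close>)
      then show ?thesis
        using H[of n] by (simp add: F_def power2_eq_square field_simps)
    qed
    have nn: "(\<integral>\<^sup>+x. ennreal (F n x) \<partial>lborel) \<le> ennreal (C * H n)" for n
      using bound by (subst nn_integral_eq_integral[OF intF]) (auto simp: F0 ennreal_leI)
    \<comment> \<open>The infimum lies below every \<open>F n\<close>, so its integral is at most
      \<open>C * H n\<close> for all \<open>n\<close>, hence 0. A vanishing infimum provides, for
      each bound, one suitable step \<open>h\<close>, which is the form claimed.\<close>
    have "(\<integral>\<^sup>+x. (INF n. ennreal (F n x)) \<partial>lborel) \<le> ennreal (C * H n)" for n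
      by (rule order_trans[OF nn_integral_mono nn[of n]]) (auto intro: INF_lower)
    moreover have "(\<lambda>n. ennreal (C * H n)) \<longlonglongrightarrow> ennreal (C * 0)"
      unfolding H_def by (intro tendsto_ennrealI tendsto_mult tendsto_const LIMSEQ_Suc lim_1_over_n)
    ultimately have "(\<integral>\<^sup>+x. (INF n. ennreal (F n x)) \<partial>lborel) \<le> ennreal (C * 0)"
      by (intro LIMSEQ_le_const) auto
    then have "AE x in lborel. (INF n. ennreal (F n x)) = 0"
      by (simp add: nn_integral_0_iff_AE)
    then show ?thesis
    proof eventually_elim
      case (elim x)
      show ?case
      proof (intro impI allI)
        fix \<epsilon> :: real assume x: "norm x < real k" and "\<epsilon> > 0"
        then have w: "w x > 0" by (simp add: w_def)
        then have "(INF n. ennreal (F n x)) < ennreal (w x * \<epsilon>)"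
          using elim \<open>\<epsilon> > 0\<close> by simp
        then obtain n where "ennreal (F n x) < ennreal (w x * \<epsilon>)"
          by (auto simp: INF_less_iff)
        then have "w x * (secdiff (Phi A) e (H n) x / H n) < w x * \<epsilon>"
          using F0[of n x] by (simp add: ennreal_less_iff F_def)
        then have "secdiff (Phi A) e (H n) x < \<epsilon> * H n"
          using w H[of n] by (simp add: field_simps)
        then show "\<exists>h>0. secdiff (Phi A) e h x < \<epsilon> * h"
          using H by blast
      qed
    qed
  qed
  then have "AE x in lborel. \<forall>k. norm x < real k \<longrightarrow> (\<forall>\<epsilon>>0. \<exists>h>0. secdiff (Phi A) e h x < \<epsilon> * h)"
    unfolding AE_all_countable ..
  then show ?thesis
    by eventually_elim (meson reals_Archimedean2)
qed

text \<open>Semicontinuity of subgradients: for a fixed step \<open>h\<close>, the subgradient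
  \<open>q\<close> at z is tested at x + h e and \<open>p\<close> at x - h e. Adding the two bounds
  h (q - p) . e by the second difference at x plus an error that vanishes as z tends to x.\<close>

lemma nearest_eventually_le:
  fixes A :: "'a::euclidean_space set"
  assumes p: "nearest A x p"
    and sec: "\<And>\<epsilon>. \<epsilon> > 0 \<Longrightarrow> \<exists>h>0. secdiff (Phi A) e h x < \<epsilon> * h" and "\<epsilon> > 0"
  shows "eventually (\<lambda>z. \<forall>q. nearest A z q \<longrightarrow> (q - p) \<bullet> e \<le> \<epsilon>) (nhds x)"
proof -
  obtain h where h: "h > 0" "secdiff (Phi A) e h x < \<epsilon> / 2 * h"
    using sec[of "\<epsilon> / 2"] \<open>\<epsilon> > 0\<close> by auto
  \<comment> \<open>A majorant of Phi A x - Phi A z + (z - x) . q that is the same for all nearest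
    points \<open>q\<close> of z, by \<open>nearest_norm_le\<close>. It is continuous and vanishes
    at x.\<close>
  define g where "g z = (Phi A x - Phi A z) + norm (z - x) * (norm z + infdist z A)" for z
  have "continuous_on UNIV g"
    unfolding g_def by (intro continuous_intros continuous_on_infdist)
  then have "(g \<longlongrightarrow> g x) (nhds x)"
    by (simp add: continuous_on_eq_continuous_at isCont_def tendsto_at_iff_tendsto_nhds)
  moreover have "g x < \<epsilon> / 2 * h"
    using h \<open>\<epsilon> > 0\<close> by (simp add: g_def)
  ultimately have "eventually (\<lambda>z. g z < \<epsilon> / 2 * h) (nhds x)"
    by (rule order_tendstoD)
  then show ?thesis
  proof eventually_elim
    case (elim z)
    show ?case
    proof (intro allI impI)
      fix q assume q: "nearest A z q"
      have "(z - x) \<bullet> q \<le> norm (z - x) * (norm z + infdist z A)"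
        using mult_left_mono[OF nearest_norm_le[OF q] norm_ge_zero]
        by (rule order_trans[OF norm_cauchy_schwarz])
      with elim have g: "Phi A x - Phi A z + (z - x) \<bullet> q < \<epsilon> / 2 * h"
        unfolding g_def by linarith
      have "Phi A (x + h *\<^sub>R e) \<ge> Phi A z + (x + h *\<^sub>R e - z) \<bullet> q"
        by (rule Phi_subgradient[OF q])
      moreover have "Phi A (x - h *\<^sub>R e) \<ge> Phi A x + (x - h *\<^sub>R e - x) \<bullet> p"
        by (rule Phi_subgradient[OF p])
      ultimately have "h * ((q - p) \<bullet> e) \<le> h * \<epsilon>"
        using g h(2) by (simp add: secdiff_def inner_commute algebra_simps)
      then show "(q - p) \<bullet> e \<le> \<epsilon>" using h(1) by simp
    qed
  qed
qed

text \<open>The nearest points of z tend to the nearest point \<open>p\<close> of x, which makes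
  \<open>p\<close> the gradient of \<open>Phi A\<close> at x. The chain rule for infdist =
  sqrt(|z|^2 - 2 Phi) then gives the gradient (x - p) / infdist x A, a unit vector.\<close>

lemma infdist_has_derivative_of_secdiff:
  fixes A :: "'a::euclidean_space set"
  assumes A: "closed A" "A \<noteq> {}" and x: "x \<notin> A"
    and sec: "\<And>i \<epsilon>. i \<in> Basis \<Longrightarrow> \<epsilon> > 0 \<Longrightarrow> \<exists>h>0. secdiff (Phi A) i h x < \<epsilon> * h"
  shows "\<exists>n. norm n = 1 \<and> ((\<lambda>z. infdist z A) has_derivative (\<lambda>v. n \<bullet> v)) (at x)"
proof -
  obtain p where p: "nearest A x p" using nearest_exists[OF A] .
  have near: "eventually (\<lambda>z. \<forall>q. nearest A z q \<longrightarrow> norm (q - p) \<le> \<epsilon>) (nhds x)" if "\<epsilon> > 0" for \<epsilon>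
  proof -
    \<comment> \<open>The norm is at most the sum of the absolute values of the coordinates, each of
      which is kept below \<open>\<epsilon>'\<close>.\<close>
    define \<epsilon>' where "\<epsilon>' = \<epsilon> / DIM('a)"
    have "\<epsilon>' > 0" using that by (simp add: \<epsilon>'_def)
    \<comment> \<open>The second difference is even in the direction, so one hypothesis controls
      both signs of a coordinate.\<close>
    have flip: "secdiff (Phi A) (- i) h x = secdiff (Phi A) i h x" for i h
      by (simp add: secdiff_def)
    have "eventually (\<lambda>z. \<forall>i\<in>Basis. \<forall>q. nearest A z q \<longrightarrow> \<bar>(q - p) \<bullet> i\<bar> \<le> \<epsilon>') (nhds x)"
    proof (intro eventually_ball_finite ballI finite_Basis)
      fix i :: 'a assume i: "i \<in> Basis"
      have "eventually (\<lambda>z. \<forall>q. nearest A z q \<longrightarrow> (q - p) \<bullet> i \<le> \<epsilon>') (nhds x)"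
        using nearest_eventually_le[OF p sec[OF i] \<open>\<epsilon>' > 0\<close>] .
      moreover have "eventually (\<lambda>z. \<forall>q. nearest A z q \<longrightarrow> (q - p) \<bullet> (- i) \<le> \<epsilon>') (nhds x)"
        using sec[OF i] by (intro nearest_eventually_le[OF p _ \<open>\<epsilon>' > 0\<close>]) (simp add: flip)
      ultimately show "eventually (\<lambda>z. \<forall>q. nearest A z q \<longrightarrow> \<bar>(q - p) \<bullet> i\<bar> \<le> \<epsilon>') (nhds x)"
        by eventually_elim (auto simp: abs_le_iff)
    qed
    then show ?thesis
    proof eventually_elim
      case (elim z)
      show ?case
      proof (intro allI impI)
        fix q assume "nearest A z q"
        with elim have "(\<Sum>i\<in>Basis. \<bar>(q - p) \<bullet> i\<bar>) \<le> (\<Sum>i\<in>(Basis::'a set). \<epsilon>')"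
          by (intro sum_mono) auto
        then show "norm (q - p) \<le> \<epsilon>"
          using norm_le_l1[of "q - p"] by (simp add: \<epsilon>'_def)
      qed
    qed
  qed
  have Phi': "(Phi A has_derivative (\<lambda>v. p \<bullet> v)) (at x)"
    unfolding has_derivative_at_alt
  proof (intro conjI allI impI bounded_linear_inner_right)
    fix \<epsilon> :: real assume "\<epsilon> > 0"
    then obtain \<delta> where \<delta>: "\<delta> > 0" "\<And>z q. dist z x < \<delta> \<Longrightarrow> nearest A z q \<Longrightarrow> norm (q - p) \<le> \<epsilon>"
      using near[of \<epsilon>] unfolding eventually_nhds_metric by blast
    have "norm (Phi A z - Phi A x - p \<bullet> (z - x)) \<le> \<epsilon> * norm (z - x)" if z: "norm (z - x) < \<delta>" for z
    proof -
      obtain q where q: "nearest A z q" using nearest_exists[OF A] .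
      \<comment> \<open>The subgradient at x makes the linearisation error nonnegative; the one at z
        bounds it above by (q - p) . (z - x).\<close>
      have "Phi A z \<ge> Phi A x + (z - x) \<bullet> p" "Phi A x \<ge> Phi A z + (x - z) \<bullet> q"
        using p q by (auto intro: Phi_subgradient)
      then have "norm (Phi A z - Phi A x - p \<bullet> (z - x)) \<le> (q - p) \<bullet> (z - x)"
        by (simp add: inner_commute algebra_simps)
      also have "\<dots> \<le> norm (q - p) * norm (z - x)" by (rule norm_cauchy_schwarz)
      also have "\<dots> \<le> \<epsilon> * norm (z - x)"
        using \<delta>(2)[OF _ q] z by (intro mult_right_mono) (auto simp: dist_norm)
      finally show ?thesis .
    qed
    then show "\<exists>d>0. \<forall>y. norm (y - x) < d \<longrightarrow> norm (Phi A y - Phi A x - p \<bullet> (y - x)) \<le> \<epsilon> * norm (y - x)"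
      using \<delta>(1) by blast
  qed
  have d: "infdist z A = sqrt (z \<bullet> z - 2 * Phi A z)" for z
  proof -
    have "z \<bullet> z - 2 * Phi A z = (infdist z A)\<^sup>2"
      by (simp add: Phi_def power2_norm_eq_inner field_simps)
    then show ?thesis by (simp add: infdist_nonneg)
  qed
  have pos: "infdist x A > 0"
    using A x by (simp add: infdist_pos_not_in_closed)
  define n where "n = (1 / infdist x A) *\<^sub>R (x - p)"
  have "((\<lambda>z. sqrt (z \<bullet> z - 2 * Phi A z)) has_derivative (\<lambda>v. n \<bullet> v)) (at x)"
    using pos by (auto intro!: derivative_eq_intros Phi'
        simp: n_def d fun_eq_iff inner_commute algebra_simps divide_simps)
  moreover have "norm n = 1"
    using p pos by (simp add: n_def nearest_def dist_norm)
  ultimately show ?thesis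
    unfolding d by blast
qed

lemma AE_infdist_has_derivative:
  fixes A :: "'a::euclidean_space set"
  assumes A: "closed A" "A \<noteq> {}"
  shows "AE x in lborel. x \<notin> A \<longrightarrow> (\<exists>n. norm n = 1 \<and> ((\<lambda>z. infdist z A) has_derivative (\<lambda>v. n \<bullet> v)) (at x))"
proof -
  have "AE x in lborel. \<forall>i\<in>Basis. \<forall>\<epsilon>>0. \<exists>h>0. secdiff (Phi A) i h x < \<epsilon> * h"
    by (intro AE_finite_allI AE_secdiff_Phi[OF A]) auto
  then show ?thesis
    by eventually_elim (use infdist_has_derivative_of_secdiff[OF A] in blast)
qed

section \<open>Mollification\<close>

lemma
  assumes "smooth_on UNIV f" "set is \<subseteq> Basis"
  shows smooth_on_continuous: "continuous_on S (iter_partial is f)"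
    and smooth_on_has_partial: "i \<in> Basis \<Longrightarrow> has_partial (iter_partial is f) i (iter_partial (i # is) f)"
  using assms
  by (auto simp: smooth_on_def has_partial_def simp del: iter_partial.simps
      intro: continuous_on_subset[of UNIV])

lemma iter_partial_eq_0:
  assumes "open U" "\<And>x. x \<in> U \<Longrightarrow> f x = 0" "x \<in> U"
  shows "iter_partial is f x = 0"
  using assms(3)
proof (induction "is" arbitrary: x)
  case (Cons i "is")
  have "((\<lambda>t::real. x + t *\<^sub>R i) \<longlongrightarrow> x + 0 *\<^sub>R i) (nhds 0)"
    by (intro tendsto_intros filterlim_ident)
  then have "eventually (\<lambda>t. x + t *\<^sub>R i \<in> U) (nhds (0::real))"
    using Cons.prems assms(1) by (simp add: topological_tendstoD)
  then have "eventually (\<lambda>t. iter_partial is f (x + t *\<^sub>R i) = 0) (nhds (0::real))"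
    by eventually_elim (rule Cons.IH)
  then have "deriv (\<lambda>t. iter_partial is f (x + t *\<^sub>R i)) 0 = deriv (\<lambda>_. 0) (0::real)"
    by (rule deriv_cong_ev) simp
  then show ?case by simp
qed (simp add: assms(2))

text \<open>The derivative bound has the scaling of rho^(-n) g(x / rho) in dimension n: n powers
  from the normalisation and one from the derivative. \<open>C\<close> is a parameter so that it can
  be kept fixed while \<open>\<rho>\<close> tends to 0.\<close>

definition mollifier :: "('a::euclidean_space \<Rightarrow> real) \<Rightarrow> real \<Rightarrow> real \<Rightarrow> bool" where
  "mollifier k \<rho> C \<longleftrightarrow> smooth_on UNIV k \<and> (\<forall>x. k x \<ge> 0) \<and> (\<forall>x. norm x > \<rho> \<longrightarrow> k x = 0) \<and>
     (LINT x|lborel. k x) = 1 \<and> (\<forall>i\<in>Basis. \<forall>x. \<bar>iter_partial [i] k x\<bar> \<le> C / \<rho> ^ (DIM('a) + 1))"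

text \<open>A tensor product of one-dimensional bumps, divided by its integral.\<close>

lemma exists_unit_mollifier:
  obtains k :: "'a::euclidean_space \<Rightarrow> real" and r where "r > 0" "smooth_on UNIV k" "\<And>x. k x \<ge> 0"
    "\<And>x. norm x > r \<Longrightarrow> k x = 0" "(LINT x|lborel. k x) = 1"
proof -
  obtain f :: "real \<Rightarrow> real" where f: "f \<in> bumps" "\<And>t. f t \<ge> 0" "f 0 > 0" "\<And>t. \<bar>t\<bar> \<ge> 1 \<Longrightarrow> f t = 0"
    by (rule exists_bump) blast
  define g where "g x = (\<Prod>b\<in>Basis. f (x \<bullet> b))" for x :: 'a
  \<comment> \<open>Beyond this radius the l1 norm exceeds the dimension, so some coordinate is at
    least 1 in absolute value and its factor vanishes.\<close>
  define r where "r = real (DIM('a))"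
  have smooth: "smooth_on UNIV g"
    unfolding g_def by (rule smooth_on_prod_bumps[OF f(1)])
  have cont: "continuous_on S g" for S
    using smooth_on_continuous[OF smooth, of "[]" S] by simp
  have g0: "g x \<ge> 0" for x
    using f(2) by (simp add: g_def prod_nonneg)
  have supp: "g x = 0" if "norm x > r" for x
  proof -
    have "\<exists>b\<in>Basis. \<bar>x \<bullet> b\<bar> \<ge> 1"
    proof (rule ccontr)
      assume "\<not> (\<exists>b\<in>Basis. \<bar>x \<bullet> b\<bar> \<ge> 1)"
      then have "(\<Sum>b\<in>Basis. \<bar>x \<bullet> b\<bar>) \<le> (\<Sum>b\<in>(Basis::'a set). 1)"
        by (intro sum_mono) (auto simp: not_le intro: less_imp_le)
      with norm_le_l1[of x] that show False by (simp add: r_def)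
    qed
    then show ?thesis using f(4) by (auto simp: g_def intro: prod_zero)
  qed
  have int: "integrable lborel g"
    by (rule integrable_compact_support[of "cball 0 r"]) (auto intro: cont supp)
  have "g 0 > 0"
    using f(3) by (simp add: g_def prod_pos)
  have "eventually (\<lambda>x. g x > g 0 / 2) (nhds 0)"
    using cont[of UNIV] \<open>g 0 > 0\<close>
    by (intro order_tendstoD(1)[of g "g 0"])
      (auto simp: continuous_on_eq_continuous_at isCont_def tendsto_at_iff_tendsto_nhds)
  then obtain \<delta> where \<delta>: "\<delta> > 0" "\<And>x. norm x < \<delta> \<Longrightarrow> g x > g 0 / 2"
    by (auto simp: eventually_nhds_metric)
  \<comment> \<open>The normalisation divides by the integral; it is positive since \<open>g\<close>
    exceeds \<open>g 0 / 2\<close> on a ball.\<close>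
  have "0 < g 0 / 2 * measure lborel (ball 0 \<delta> :: 'a set)"
    using \<open>g 0 > 0\<close> content_ball_pos[OF \<delta>(1), of "0::'a"] by simp
  also have "\<dots> = (LINT x::'a|lborel. indicator (ball 0 \<delta>) x *\<^sub>R (g 0 / 2))"
    by simp
  also have "\<dots> \<le> (LINT x|lborel. g x)"
    using \<delta> g0 int less_imp_le by (intro integral_mono') (auto simp: indicator_def)
  finally have I: "(LINT x|lborel. g x) > 0" .
  show ?thesis
  proof
    show "r > 0" by (simp add: r_def)
    show "smooth_on UNIV (\<lambda>x. 1 / (LINT x|lborel. g x) * g (0 + 1 *\<^sub>R x))"
      by (rule smooth_on_affine[OF smooth])
  qed (use I g0 supp in auto)
qed

lemma exists_mollifier:
  obtains C where "C > 0" "\<And>\<rho>. \<rho> > 0 \<Longrightarrow> \<exists>k::'a::euclidean_space \<Rightarrow> real. mollifier k \<rho> C"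
proof -
  obtain g :: "'a \<Rightarrow> real" and r where g: "r > 0" "smooth_on UNIV g" "\<And>x. g x \<ge> 0"
    "\<And>x. norm x > r \<Longrightarrow> g x = 0" "(LINT x|lborel. g x) = 1"
    by (rule exists_unit_mollifier) blast
  have "\<exists>M>0. \<forall>x. \<bar>iter_partial [i] g x\<bar> \<le> M" if "i \<in> Basis" for i
  proof -
    have c: "continuous_on (cball 0 r) (iter_partial [i] g)"
      using that by (intro smooth_on_continuous[OF g(2)]) auto
    have z: "iter_partial [i] g x = 0" if "x \<notin> cball 0 r" for x
      using that by (intro iter_partial_eq_0[of "- cball 0 r"]) (auto simp: g(4))
    show ?thesis
      using bounded_compact_support[OF compact_cball c z] by blast
  qed
  then have "\<forall>i\<in>Basis. \<exists>M>0. \<forall>x. \<bar>iter_partial [i] g x\<bar> \<le> M" by blast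
  then obtain M where M: "\<forall>i\<in>Basis. M i > 0 \<and> (\<forall>x. \<bar>iter_partial [i] g x\<bar> \<le> M i)"
    by (rule bchoice[THEN exE])
  define N where "N = (\<Sum>i\<in>Basis. M i)"
  have N: "N > 0"
    unfolding N_def using M by (intro sum_pos) auto
  have MN: "\<bar>iter_partial [i] g x\<bar> \<le> N" if "i \<in> Basis" for i x
  proof -
    have "\<bar>iter_partial [i] g x\<bar> \<le> M i" using M that by blast
    also have "\<dots> \<le> N"
      unfolding N_def using M that by (intro member_le_sum) (auto intro: less_imp_le)
    finally show ?thesis .
  qed
  show ?thesis
  proof (rule that)
    show "r ^ (DIM('a) + 1) * N > 0" using g(1) N by simp
    fix \<rho> :: real assume "\<rho> > 0"
    \<comment> \<open>Scaling by \<open>c\<close> shrinks the support radius from \<open>r\<close>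
      to \<open>\<rho>\<close>. A prefactor c^n keeps the mass 1, and a derivative costs one more
      \<open>c\<close>, whence the constant r^(n+1) N.\<close>
    define c where "c = r / \<rho>"
    have c: "c > 0" using g(1) \<open>\<rho> > 0\<close> by (simp add: c_def)
    define k where "k x = c ^ DIM('a) * g (0 + c *\<^sub>R x)" for x
    have "mollifier k \<rho> (r ^ (DIM('a) + 1) * N)"
      unfolding mollifier_def
    proof (intro conjI allI ballI impI)
      show "smooth_on UNIV k"
        unfolding k_def by (rule smooth_on_affine[OF g(2)])
      show "k x \<ge> 0" for x using g(3) c by (simp add: k_def)
      show "k x = 0" if "norm x > \<rho>" for x
      proof -
        have "norm (c *\<^sub>R x) > r" using that \<open>\<rho> > 0\<close> g(1) by (simp add: c_def field_simps)
        then show ?thesis using g(4) by (simp add: k_def)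
      qed
      have "g \<in> borel_measurable borel"
        using smooth_on_continuous[OF g(2), of "[]" UNIV] by (simp add: borel_measurable_continuous_onI)
      then show "(LINT x|lborel. k x) = 1"
        using lborel_integral_affine[of g c 0] c g(5) by (simp add: k_def)
      fix i x :: 'a assume i: "i \<in> Basis"
      have "iter_partial [i] k x = c ^ DIM('a) * c ^ length [i] * iter_partial [i] g (0 + c *\<^sub>R x)"
        unfolding k_def using i by (subst iter_partial_affine(1)[OF g(2)]) auto
      then have "\<bar>iter_partial [i] k x\<bar> = c ^ (DIM('a) + 1) * \<bar>iter_partial [i] g (c *\<^sub>R x)\<bar>"
        using c by (simp add: abs_mult del: iter_partial.simps)
      also have "\<dots> \<le> c ^ (DIM('a) + 1) * N"
        using MN[OF i] c by (intro mult_left_mono) auto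
      finally show "\<bar>iter_partial [i] k x\<bar> \<le> r ^ (DIM('a) + 1) * N / \<rho> ^ (DIM('a) + 1)"
        by (simp add: c_def power_divide)
    qed
    then show "\<exists>k::'a \<Rightarrow> real. mollifier k \<rho> (r ^ (DIM('a) + 1) * N)" by blast
  qed
qed

lemma
  fixes k :: "'a::euclidean_space \<Rightarrow> real"
  assumes k: "mollifier k \<rho> C" and i: "set is \<subseteq> Basis"
  shows mollifier_continuous: "continuous_on S (iter_partial is k)"
    and mollifier_support: "norm x > \<rho> \<Longrightarrow> iter_partial is k x = 0"
    and mollifier_has_partial: "i \<in> Basis \<Longrightarrow> has_partial (iter_partial is k) i (iter_partial (i # is) k)"
proof -
  show "continuous_on S (iter_partial is k)"
    "i \<in> Basis \<Longrightarrow> has_partial (iter_partial is k) i (iter_partial (i # is) k)"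
    using k i by (auto simp: mollifier_def simp del: iter_partial.simps
        intro: smooth_on_continuous smooth_on_has_partial)
  show "norm x > \<rho> \<Longrightarrow> iter_partial is k x = 0"
    using k by (intro iter_partial_eq_0[of "- cball 0 \<rho>"]) (auto simp: mollifier_def)
qed

lemma mollifier_integrable:
  fixes f k :: "'a::euclidean_space \<Rightarrow> real"
  assumes k: "mollifier k \<rho> C" and "set is \<subseteq> Basis" "continuous_on UNIV f"
  shows "integrable lborel (\<lambda>y. f y * iter_partial is k y)"
    and "integrable lborel (\<lambda>y. f y * iter_partial is k (x - y))"
proof -
  note cont = mollifier_continuous[OF k \<open>set is \<subseteq> Basis\<close>]
    and supp = mollifier_support[OF k \<open>set is \<subseteq> Basis\<close>]
  show "integrable lborel (\<lambda>y. f y * iter_partial is k y)"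
  proof (rule integrable_compact_support[of "cball 0 \<rho>"])
    show "continuous_on (cball 0 \<rho>) (\<lambda>y. f y * iter_partial is k y)"
      using assms(3) by (intro continuous_on_mult cont) (rule continuous_on_subset, auto)
  qed (auto simp: supp)
  show "integrable lborel (\<lambda>y. f y * iter_partial is k (x - y))"
  proof (rule integrable_compact_support[of "cball x \<rho>"])
    show "continuous_on (cball x \<rho>) (\<lambda>y. f y * iter_partial is k (x - y))"
      using assms(3)
      by (intro continuous_on_mult continuous_on_compose2[OF cont[of UNIV]] continuous_intros)
        (auto intro: continuous_on_subset)
  qed (auto simp: supp dist_norm)
qed

lemma
  fixes d k :: "'a::euclidean_space \<Rightarrow> real"
  assumes k: "mollifier k \<rho> C" and d: "continuous_on UNIV d" and i: "set is \<subseteq> Basis"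
  shows conv_mollifier_continuous: "continuous_on S (conv d (iter_partial is k))"
    and conv_mollifier_has_partial:
      "i \<in> Basis \<Longrightarrow> has_partial (conv d (iter_partial is k)) i (conv d (iter_partial (i # is) k))"
proof -
  show "continuous_on S (conv d (iter_partial is k))"
    by (rule conv_continuous[OF d mollifier_continuous[OF k i] mollifier_support[OF k i]])
  assume "i \<in> Basis"
  then have i': "set (i # is) \<subseteq> Basis" using i by simp
  show "has_partial (conv d (iter_partial is k)) i (conv d (iter_partial (i # is) k))"
    by (rule conv_has_partial[OF d mollifier_continuous[OF k i] mollifier_support[OF k i]
          mollifier_continuous[OF k i'] mollifier_support[OF k i'] mollifier_has_partial[OF k i \<open>i \<in> Basis\<close>] \<open>i \<in> Basis\<close>])
qed

text \<open>\<open>conv d k x\<close> is a weighted average of the values of \<open>d\<close> on the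
  ball of radius \<open>\<rho>\<close> around x.\<close>

lemma
  fixes d k :: "'a::euclidean_space \<Rightarrow> real"
  assumes k: "mollifier k \<rho> C" and d: "continuous_on UNIV d"
  shows conv_mollifier_ge: "(\<And>y. norm y \<le> \<rho> \<Longrightarrow> m \<le> d (x - y)) \<Longrightarrow> m \<le> conv d k x"
    and conv_mollifier_le: "(\<And>y. norm y \<le> \<rho> \<Longrightarrow> d (x - y) \<le> M) \<Longrightarrow> conv d k x \<le> M"
proof -
  have k0: "k y \<ge> 0" "norm y > \<rho> \<Longrightarrow> k y = 0" "(LINT x|lborel. k x) = 1" for y
    using k by (auto simp: mollifier_def)
  have contk: "continuous_on UNIV k"
    using mollifier_continuous[OF k, of "[]" UNIV] by simp
  have d': "continuous_on UNIV (\<lambda>y. d (x - y))"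
    by (intro continuous_on_compose2[OF d] continuous_intros) auto
  have int: "integrable lborel (\<lambda>y. d (x - y) * k y)" "integrable lborel (\<lambda>y. c * k y)" for c
    using mollifier_integrable(1)[OF k, of "[]", OF _ d']
      mollifier_integrable(1)[OF k, of "[]", OF _ continuous_on_const] by simp_all
  have conv: "conv d k x = (LINT y|lborel. d (x - y) * k y)"
    by (rule conv_commute[OF d contk])
  have const: "(LINT y|lborel. c * k y) = c" for c
    using k0(3) by simp
  show "m \<le> conv d k x" if m: "\<And>y. norm y \<le> \<rho> \<Longrightarrow> m \<le> d (x - y)"
  proof -
    have "m * k y \<le> d (x - y) * k y" for y
      using m[of y] k0(1,2)[of y] by (cases "norm y \<le> \<rho>") (auto intro: mult_right_mono)
    then have "(LINT y|lborel. m * k y) \<le> conv d k x"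
      unfolding conv by (intro Bochner_Integration.integral_mono int)
    then show ?thesis by (simp only: const)
  qed
  show "conv d k x \<le> M" if m: "\<And>y. norm y \<le> \<rho> \<Longrightarrow> d (x - y) \<le> M"
  proof -
    have "d (x - y) * k y \<le> M * k y" for y
      using m[of y] k0(1,2)[of y] by (cases "norm y \<le> \<rho>") (auto intro: mult_right_mono)
    then have "conv d k x \<le> (LINT y|lborel. M * k y)"
      unfolding conv by (intro Bochner_Integration.integral_mono int)
    then show ?thesis by (simp only: const)
  qed
qed

text \<open>The derivative of the kernel has integral 0 and its integral against v . y is -(v . i),
  so an affine \<open>d\<close> with slope \<open>v\<close> would give v . i exactly. The remainder
  is at most tau rho times C rho^(-n-1) on a ball of volume proportional to rho^n: all powers of rho
  cancel. The choice v = 0 yields a uniform bound, the gradient of \<open>d\<close> yields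
  convergence.\<close>

lemma conv_mollifier_partial_approx:
  fixes d k :: "'a::euclidean_space \<Rightarrow> real"
  assumes k: "mollifier k \<rho> C" and \<rho>: "\<rho> > 0" and d: "continuous_on UNIV d" and i: "i \<in> Basis"
    and approx: "\<And>y. norm y \<le> \<rho> \<Longrightarrow> \<bar>d (x - y) - d x + v \<bullet> y\<bar> \<le> \<tau> * \<rho>" and \<tau>: "\<tau> \<ge> 0"
  shows "\<bar>conv d (iter_partial [i] k) x - v \<bullet> i\<bar> \<le> \<tau> * C * measure lborel (ball (0::'a) 1)"
proof -
  define ki where "ki = iter_partial [i] k"
  have ki: "continuous_on S ki" "norm y > \<rho> \<Longrightarrow> ki y = 0" "\<bar>ki y\<bar> \<le> C / \<rho> ^ (DIM('a) + 1)" for S y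
    using mollifier_continuous[OF k, of "[i]"] mollifier_support[OF k, of "[i]"] k i
    by (auto simp: ki_def mollifier_def simp del: iter_partial.simps)
  have k0: "continuous_on S k" "norm y > \<rho> \<Longrightarrow> k y = 0" "(LINT x|lborel. k x) = 1" for S y
    using mollifier_continuous[OF k, of "[]"] mollifier_support[OF k, of "[]"] k
    by (auto simp: mollifier_def)
  have part: "has_partial k i ki"
    using mollifier_has_partial[OF k, of "[]" i] i unfolding ki_def by simp
  have int: "integrable lborel (\<lambda>y. f y * ki y)" "integrable lborel (\<lambda>y. f y * k y)"
    if "continuous_on UNIV f" for f
    using mollifier_integrable(1)[OF k, of "[i]"] mollifier_integrable(1)[OF k, of "[]"] that i
    by (auto simp: ki_def simp del: iter_partial.simps(2))
  have d': "continuous_on UNIV (\<lambda>y. d (x - y))"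
    by (intro continuous_on_compose2[OF d] continuous_intros) auto
  have 0: "(LINT y|lborel. ki y) = 0"
    by (rule integral_partial_eq_0[OF k0(1) ki(1) part i k0(2) ki(2)])
  \<comment> \<open>The integrand is the partial derivative of the compactly supported function (v .
    y) k(y).\<close>
  have "(LINT y|lborel. (v \<bullet> y) * ki y + (v \<bullet> i) * k y) = 0"
  proof (rule integral_partial_eq_0[where r = \<rho> and i = i])
    show "has_partial (\<lambda>y. (v \<bullet> y) * k y) i (\<lambda>y. (v \<bullet> y) * ki y + (v \<bullet> i) * k y)"
      using part unfolding has_partial_def
      by (auto intro!: derivative_eq_intros simp: inner_add_right)
  qed (use i k0 ki in \<open>auto intro!: continuous_intros\<close>)
  moreover have "integrable lborel (\<lambda>y. (v \<bullet> y) * ki y)" "integrable lborel (\<lambda>y. (v \<bullet> i) * k y)"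
    by (intro int continuous_intros)+
  ultimately have vk: "(LINT y|lborel. (v \<bullet> y) * ki y) = - (v \<bullet> i)"
    using k0(3) by simp
  have "conv d ki x - v \<bullet> i = (LINT y|lborel. d (x - y) * ki y) - (LINT y|lborel. d x * ki y) + (LINT y|lborel. (v \<bullet> y) * ki y)"
    using conv_commute[OF d ki(1)] 0 vk by simp
  also have "\<dots> = (LINT y|lborel. (d (x - y) - d x + v \<bullet> y) * ki y)"
    using int(1)[OF d'] int(1)[of "\<lambda>_. d x"] int(1)[of "\<lambda>y. v \<bullet> y"]
    by (simp add: continuous_on_inner left_diff_distrib distrib_right
        del: integral_mult_right_zero integral_mult_right)
  finally have eq: "conv d ki x - v \<bullet> i = (LINT y|lborel. (d (x - y) - d x + v \<bullet> y) * ki y)" .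
  have "\<bar>conv d ki x - v \<bullet> i\<bar> \<le>
      (LINT y::'a|lborel. indicator (cball 0 \<rho>) y *\<^sub>R (\<tau> * \<rho> * (C / \<rho> ^ (DIM('a) + 1))))"
    unfolding eq
  proof (rule integral_abs_bound_integral)
    show "integrable lborel (\<lambda>y. (d (x - y) - d x + v \<bullet> y) * ki y)"
      using d' by (intro int continuous_intros)
    show "integrable lborel (\<lambda>y::'a. indicator (cball 0 \<rho>) y *\<^sub>R (\<tau> * \<rho> * (C / \<rho> ^ (DIM('a) + 1))))"
      by (intro borel_integrable_compact continuous_intros) auto
    show "\<bar>(d (x - y) - d x + v \<bullet> y) * ki y\<bar> \<le> indicator (cball 0 \<rho>) y *\<^sub>R (\<tau> * \<rho> * (C / \<rho> ^ (DIM('a) + 1)))" for y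
    proof (cases "norm y \<le> \<rho>")
      case True
      then have "\<bar>(d (x - y) - d x + v \<bullet> y)\<bar> * \<bar>ki y\<bar> \<le> \<tau> * \<rho> * (C / \<rho> ^ (DIM('a) + 1))"
        using approx[OF True] ki(3)[of y] \<tau> \<rho> by (intro mult_mono) auto
      then show ?thesis using True by (simp add: abs_mult)
    next
      case False
      then show ?thesis using ki(2)[of y] by simp
    qed
  qed
  also have "\<dots> = \<tau> * \<rho> * (C / \<rho> ^ (DIM('a) + 1)) * measure lborel (cball (0::'a) \<rho>)"
    by simp
  also have "\<dots> = \<tau> * C * measure lborel (ball (0::'a) 1)"
    using \<rho> content_ball_conv_unit_ball[of \<rho> "0::'a"] content_cball_conv_ball[of "0::'a" \<rho>]
    by (simp add: field_simps)
  finally show ?thesis by (simp only: ki_def)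
qed

text \<open>Passes from the set integrals of the theorem to Borel integrals on the whole space;
  completing the measure does not change integrals of Borel functions.\<close>

lemma set_lebesgue_integral_eq_lborel:
  fixes f :: "'a::euclidean_space \<Rightarrow> real"
  assumes "\<And>x. x \<notin> S \<Longrightarrow> f x = 0" "f \<in> borel_measurable lborel"
  shows "(LINT x:S|lebesgue. f x) = (LINT x|lborel. f x)"
proof -
  have "(\<lambda>x. indicator S x *\<^sub>R f x) = f"
    using assms(1) by (auto simp: indicator_def fun_eq_iff)
  then show ?thesis
    using integral_completion[OF assms(2)] by (simp add: set_lebesgue_integral_def)
qed

text \<open>The reflected kernel y -> k(x - y) is a nonnegative test function supported in the ball
  around x; it turns the distributional sign into a pointwise one.\<close>

lemma conv_superharmonic:
  fixes d k :: "'a::euclidean_space \<Rightarrow> real"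
  assumes sh: "distr_superharmonic \<Omega> d" and d: "continuous_on UNIV d" "\<And>y. y \<notin> \<Omega> \<Longrightarrow> d y = 0"
    and k: "mollifier k \<rho> C" and x: "cball x \<rho> \<subseteq> \<Omega>"
  shows "(\<Sum>i\<in>Basis. conv d (iter_partial [i, i] k) x) \<le> 0"
proof -
  define \<phi> where "\<phi> y = 1 * k (x + (- 1) *\<^sub>R y)" for y
  have smooth: "smooth_on UNIV k" using k by (simp add: mollifier_def)
  have supp: "tsupport \<phi> \<subseteq> cball x \<rho>"
    unfolding tsupport_def
  proof (rule closure_minimal)
    show "{y. \<phi> y \<noteq> 0} \<subseteq> cball x \<rho>"
      using mollifier_support[OF k, of "[]"] by (auto simp: \<phi>_def dist_norm not_less[symmetric])
  qed simp
  have "test_fun \<Omega> \<phi>"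
    unfolding test_fun_def
  proof (intro conjI)
    show "smooth_on UNIV \<phi>"
      unfolding \<phi>_def by (rule smooth_on_affine[OF smooth])
    show "compact (tsupport \<phi>)"
      using supp by (intro compact_eq_bounded_closed[THEN iffD2] conjI bounded_subset[OF bounded_cball])
        (auto simp: tsupport_def)
  qed (use supp x in auto)
  moreover have "\<phi> y \<ge> 0" for y
    using k by (simp add: \<phi>_def mollifier_def)
  ultimately have le: "(LINT y:\<Omega>|lebesgue. d y * laplacian \<phi> y) \<le> 0"
    using sh by (simp add: distr_superharmonic_def)
  \<comment> \<open>Two derivatives of the reflected kernel produce the sign (-1)^2 = 1.\<close>
  have lap: "laplacian \<phi> y = (\<Sum>i\<in>Basis. iter_partial [i, i] k (x - y))" for y
    unfolding laplacian_def \<phi>_def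
  proof (intro sum.cong refl)
    fix i :: 'a assume "i \<in> Basis"
    then show "iter_partial [i, i] (\<lambda>y. 1 * k (x + (- 1) *\<^sub>R y)) y = iter_partial [i, i] k (x - y)"
      by (subst iter_partial_affine(1)[OF smooth]) auto
  qed
  have int: "integrable lborel (\<lambda>y. d y * iter_partial [i, i] k (x - y))" if "i \<in> Basis" for i
    using mollifier_integrable(2)[OF k, of "[i, i]"] d(1) that by (auto simp del: iter_partial.simps)
  have "(LINT y:\<Omega>|lebesgue. d y * laplacian \<phi> y) = (LINT y|lborel. d y * laplacian \<phi> y)"
  proof (rule set_lebesgue_integral_eq_lborel)
    show "(\<lambda>y. d y * laplacian \<phi> y) \<in> borel_measurable lborel"
      unfolding lap sum_distrib_left using int by (intro borel_measurable_sum) auto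
  qed (simp add: d(2))
  also have "\<dots> = (\<Sum>i\<in>Basis. conv d (iter_partial [i, i] k) x)"
    unfolding lap conv_def sum_distrib_left using int
    by (subst Bochner_Integration.integral_sum) auto
  finally show ?thesis using le by linarith
qed

section \<open>The smooth inequality\<close>

text \<open>The open sets \<open>U\<close> and \<open>- K\<close> cover the space and
  \<open>f\<close> is continuous on each. This is applied to products containing h(D), where
  \<open>h\<close> is controlled only on an interval.\<close>

lemma continuous_extend_by_0:
  fixes f :: "'a::topological_space \<Rightarrow> real"
  assumes "open U" "closed K" "K \<subseteq> U" "continuous_on U f" "\<And>x. x \<notin> K \<Longrightarrow> f x = 0"
  shows "continuous_on UNIV f"
proof -
  have "continuous_on (- K) f"
    using assms(5) by (subst continuous_on_cong[of "- K" "- K" f "\<lambda>_. 0"]) auto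
  then have "continuous_on (U \<union> - K) f"
    using assms by (intro continuous_on_open_Un) auto
  moreover have "U \<union> - K = UNIV" using assms(3) by auto
  ultimately show ?thesis by simp
qed

lemma has_partial_cong_0:
  fixes F :: "'a::euclidean_space \<Rightarrow> real"
  assumes "closed K" "\<And>x. x \<notin> K \<Longrightarrow> F x = 0" "x \<notin> K"
  shows "((\<lambda>t. F (x + t *\<^sub>R i)) has_real_derivative 0) (at 0)"
proof -
  have "((\<lambda>t::real. x + t *\<^sub>R i) \<longlongrightarrow> x + 0 *\<^sub>R i) (nhds 0)"
    by (intro tendsto_intros filterlim_ident)
  then have "eventually (\<lambda>t. x + t *\<^sub>R i \<in> - K) (nhds (0::real))"
    using assms by (intro topological_tendstoD[of _ "x + 0 *\<^sub>R i"]) auto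
  then have "eventually (\<lambda>t. F (x + t *\<^sub>R i) = 0) (nhds (0::real))"
    by eventually_elim (simp add: assms(2))
  then show ?thesis
    by (subst DERIV_cong_ev[OF refl _ refl]) auto
qed

text \<open>Integrates the divergence of the field \<open>b * h(D) * \<nabla>D\<close>.\<close>

lemma divergence_inequality:
  fixes D b :: "'a::euclidean_space \<Rightarrow> real" and Di Dii bi :: "'a \<Rightarrow> 'a \<Rightarrow> real"
  assumes K: "compact K"
    and D: "continuous_on UNIV D" "\<And>i. i \<in> Basis \<Longrightarrow> continuous_on UNIV (Di i)"
      "\<And>i. i \<in> Basis \<Longrightarrow> continuous_on UNIV (Dii i)"
      "\<And>i. i \<in> Basis \<Longrightarrow> has_partial D i (Di i)" "\<And>i. i \<in> Basis \<Longrightarrow> has_partial (Di i) i (Dii i)"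
    and b: "continuous_on UNIV b" "\<And>i. i \<in> Basis \<Longrightarrow> continuous_on UNIV (bi i)"
      "\<And>i. i \<in> Basis \<Longrightarrow> has_partial b i (bi i)" "\<And>x. x \<notin> K \<Longrightarrow> b x = 0"
      "\<And>i x. i \<in> Basis \<Longrightarrow> x \<notin> K \<Longrightarrow> bi i x = 0" "\<And>x. b x \<ge> 0"
    and h: "\<And>t. 0 < t \<Longrightarrow> t < T \<Longrightarrow> (h has_real_derivative h' t) (at t)" "continuous_on {0<..<T} h'"
    and DK: "\<And>x. x \<in> K \<Longrightarrow> 0 < D x" "\<And>x. x \<in> K \<Longrightarrow> D x < T" "\<And>x. x \<in> K \<Longrightarrow> h (D x) \<ge> 0"
      "\<And>x. x \<in> K \<Longrightarrow> (\<Sum>i\<in>Basis. Dii i x) \<le> 0"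
  shows "(LINT x|lborel. b x * (- h' (D x) * (\<Sum>i\<in>Basis. (Di i x)\<^sup>2))) \<le>
    (LINT x|lborel. (\<Sum>i\<in>Basis. bi i x * (h (D x) * Di i x)))"
proof -
  \<comment> \<open>An open neighbourhood of \<open>K\<close> on which \<open>h\<close> and
    \<open>h'\<close> are evaluated inside their interval.\<close>
  define U where "U = D -` {0<..<T}"
  have U: "open U" "K \<subseteq> U"
    using D(1) DK(1,2) by (auto simp: U_def intro: open_vimage)
  have conth: "continuous_on {0<..<T} h"
    using h(1) by (intro DERIV_continuous_on[of _ h h']) (auto intro: has_field_derivative_at_within)
  have contD: "continuous_on U (\<lambda>x. h (D x))" "continuous_on U (\<lambda>x. h' (D x))"
    by (auto simp: U_def intro!: continuous_on_compose2[OF conth] continuous_on_compose2[OF h(2)]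
        continuous_on_subset[OF D(1)])
  obtain r where r: "\<And>x. x \<in> K \<Longrightarrow> norm x \<le> r"
    using compact_imp_bounded[OF K] unfolding bounded_iff by blast
  have off: "x \<notin> K" if "norm x > r" for x
    using that r[of x] by linarith
  define F where "F i x = b x * (h (D x) * Di i x)" for i x
  \<comment> \<open>The product rule for \<open>F i\<close>, with derivatives falling on b, on h(D)
    and on the gradient of D. Summed over i, the last part is b h(D) times the Laplacian of D, which
    is nonpositive.\<close>
  define G where "G i x = bi i x * (h (D x) * Di i x) + b x * (h' (D x) * (Di i x)\<^sup>2) + b x * (h (D x) * Dii i x)" for i x
  have cont: "continuous_on U (\<lambda>x. bi i x * (h (D x) * Di i x))"
    "continuous_on U (\<lambda>x. b x * (h' (D x) * (Di i x)\<^sup>2))"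
    "continuous_on U (\<lambda>x. b x * (h (D x) * Dii i x))"
    if "i \<in> Basis" for i
  proof -
    note [intro] = contD continuous_on_subset[OF b(1) subset_UNIV] continuous_on_subset[OF b(2)[OF that] subset_UNIV]
      continuous_on_subset[OF D(2)[OF that] subset_UNIV] continuous_on_subset[OF D(3)[OF that] subset_UNIV]
    show "continuous_on U (\<lambda>x. bi i x * (h (D x) * Di i x))"
      "continuous_on U (\<lambda>x. b x * (h' (D x) * (Di i x)\<^sup>2))"
      "continuous_on U (\<lambda>x. b x * (h (D x) * Dii i x))"
      by (intro continuous_on_mult continuous_on_power; rule)+
  qed
  have int: "integrable lborel (\<lambda>x. bi i x * (h (D x) * Di i x))"
    "integrable lborel (\<lambda>x. b x * (h' (D x) * (Di i x)\<^sup>2))"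
    "integrable lborel (\<lambda>x. b x * (h (D x) * Dii i x))" if "i \<in> Basis" for i
    using b(4) b(5)[OF that]
    by (intro integrable_compact_support[OF K] continuous_on_subset[OF cont(1)[OF that] U(2)]
        continuous_on_subset[OF cont(2)[OF that] U(2)] continuous_on_subset[OF cont(3)[OF that] U(2)]; simp)+
  have zero: "(LINT x|lborel. G i x) = 0" if i: "i \<in> Basis" for i
  proof (rule integral_partial_eq_0[where r = r])
    note subset = continuous_on_subset[OF _ subset_UNIV]
    have "continuous_on U (F i)"
      unfolding F_def[abs_def]
      by (intro continuous_on_mult contD subset[OF b(1)] subset[OF D(2)[OF i]])
    then show "continuous_on UNIV (F i)"
      by (rule continuous_extend_by_0[OF U(1) compact_imp_closed[OF K] U(2)]) (simp add: F_def b(4))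
    have "continuous_on U (G i)"
      unfolding G_def[abs_def] by (intro continuous_on_add cont[OF i])
    then show "continuous_on UNIV (G i)"
      by (rule continuous_extend_by_0[OF U(1) compact_imp_closed[OF K] U(2)]) (simp add: G_def b(4) b(5)[OF i])
    show "has_partial (F i) i (G i)"
      unfolding has_partial_def
    proof
      fix x
      show "((\<lambda>t. F i (x + t *\<^sub>R i)) has_real_derivative G i x) (at 0)"
      proof (cases "x \<in> K")
        case True
        have "(h has_real_derivative h' (D x)) (at (D (x + 0 *\<^sub>R i)))"
          using h(1) DK(1,2)[OF True] by simp
        moreover have "((\<lambda>t. D (x + t *\<^sub>R i)) has_real_derivative Di i x) (at 0)"
          using D(4)[OF i] by (simp add: has_partial_def)
        ultimately have hD: "((\<lambda>t. h (D (x + t *\<^sub>R i))) has_real_derivative h' (D x) * Di i x) (at 0)"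
          by (rule DERIV_chain2)
        have "((\<lambda>t. b (x + t *\<^sub>R i)) has_real_derivative bi i x) (at 0)"
          "((\<lambda>t. Di i (x + t *\<^sub>R i)) has_real_derivative Dii i x) (at 0)"
          using b(3)[OF i] D(5)[OF i] by (simp_all add: has_partial_def)
        then show ?thesis
          unfolding F_def G_def
          by (auto intro!: derivative_eq_intros hD simp: power2_eq_square algebra_simps)
      next
        case False
        then have "G i x = 0" using b(4) b(5)[OF i] by (simp add: G_def)
        moreover have "((\<lambda>t. F i (x + t *\<^sub>R i)) has_real_derivative 0) (at 0)"
          using False b(4) by (intro has_partial_cong_0[OF compact_imp_closed[OF K]]) (auto simp: F_def)
        ultimately show ?thesis by simp
      qed
    qed
    show "F i x = 0" "G i x = 0" if "norm x > r" for x
      using off[OF that] b(4) b(5)[OF i] by (auto simp: F_def G_def)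
  qed (rule i)
  define A where "A x = (\<Sum>i\<in>Basis. bi i x * (h (D x) * Di i x))" for x
  define B where "B x = (\<Sum>i\<in>Basis. b x * (h' (D x) * (Di i x)\<^sup>2))" for x
  define E where "E x = (\<Sum>i\<in>Basis. b x * (h (D x) * Dii i x))" for x
  have intABE: "integrable lborel A" "integrable lborel B" "integrable lborel E"
    unfolding A_def B_def E_def using int by (auto intro!: Bochner_Integration.integrable_sum)
  have "0 = (\<Sum>i\<in>Basis. LINT x|lborel. G i x)"
    using zero by simp
  also have "\<dots> = (LINT x|lborel. (\<Sum>i\<in>Basis. G i x))"
    using int by (subst Bochner_Integration.integral_sum) (auto simp: G_def[abs_def])
  also have "\<dots> = (LINT x|lborel. A x + B x + E x)"
    by (simp add: G_def A_def B_def E_def sum.distrib)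
  also have "\<dots> = (LINT x|lborel. A x) + (LINT x|lborel. B x) + (LINT x|lborel. E x)"
    using intABE by simp
  finally have "0 = (LINT x|lborel. A x) + (LINT x|lborel. B x) + (LINT x|lborel. E x)" .
  moreover have "(LINT x|lborel. E x) \<le> 0"
  proof -
    have "E x \<le> 0" for x
    proof (cases "x \<in> K")
      case True
      have "E x = b x * (h (D x) * (\<Sum>i\<in>Basis. Dii i x))"
        by (simp add: E_def sum_distrib_left)
      also have "\<dots> \<le> 0"
        using b(6) DK(3,4)[OF True] by (intro mult_nonneg_nonpos)
      finally show ?thesis .
    qed (simp add: E_def b(4))
    then show ?thesis
      using Bochner_Integration.integral_nonneg[where M = lborel and f = "\<lambda>x. - E x"] by simp
  qed
  ultimately have "- (LINT x|lborel. B x) \<le> (LINT x|lborel. A x)"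
    by linarith
  moreover have "b x * (- h' (D x) * (\<Sum>i\<in>Basis. (Di i x)\<^sup>2)) = - B x" for x
    by (simp add: B_def sum_distrib_left sum_negf)
  ultimately show ?thesis by (simp add: A_def)
qed

lemma conv_mollifier_partial_tendsto:
  fixes d :: "'a::euclidean_space \<Rightarrow> real"
  assumes k: "\<And>n. mollifier (k n) (\<rho> n) C" and \<rho>: "\<And>n. \<rho> n > 0" "\<rho> \<longlonglongrightarrow> 0"
    and d: "continuous_on UNIV d" "(d has_derivative (\<lambda>w. v \<bullet> w)) (at x)" and i: "i \<in> Basis" and C: "C > 0"
  shows "(\<lambda>n. conv d (iter_partial [i] (k n)) x) \<longlonglongrightarrow> v \<bullet> i"
proof (rule metric_LIMSEQ_I)
  fix e :: real assume "e > 0"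
  define V where "V = C * measure lborel (ball (0::'a) 1)"
  have V: "V > 0" unfolding V_def using C content_ball_pos[of 1 "0::'a"] by simp
  \<comment> \<open>The approximation estimate is \<open>\<tau> * V\<close>, which becomes
    e/2.\<close>
  define \<tau> where "\<tau> = e / (2 * V)"
  have \<tau>: "\<tau> > 0" using \<open>e > 0\<close> V by (simp add: \<tau>_def)
  obtain \<delta> where \<delta>: "\<delta> > 0" "\<And>y. norm (y - x) < \<delta> \<Longrightarrow> norm (d y - d x - v \<bullet> (y - x)) \<le> \<tau> * norm (y - x)"
    using d(2) \<tau> unfolding has_derivative_at_alt by blast
  obtain N where N: "\<And>n. n \<ge> N \<Longrightarrow> \<rho> n < \<delta>"
    using order_tendstoD(2)[OF \<rho>(2) \<delta>(1)] by (auto simp: eventually_sequentially)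
  show "\<exists>N. \<forall>n\<ge>N. dist (conv d (iter_partial [i] (k n)) x) (v \<bullet> i) < e"
  proof (intro exI allI impI)
    fix n assume "n \<ge> N"
    have "\<bar>conv d (iter_partial [i] (k n)) x - v \<bullet> i\<bar> \<le> \<tau> * C * measure lborel (ball (0::'a) 1)"
    proof (rule conv_mollifier_partial_approx[OF k \<rho>(1) d(1) i])
      fix y :: 'a assume y: "norm y \<le> \<rho> n"
      have "\<bar>d (x - y) - d x + v \<bullet> y\<bar> \<le> \<tau> * norm y"
        using \<delta>(2)[of "x - y"] y N[OF \<open>n \<ge> N\<close>] by simp
      also have "\<dots> \<le> \<tau> * \<rho> n" using y \<tau> by (intro mult_left_mono) auto
      finally show "\<bar>d (x - y) - d x + v \<bullet> y\<bar> \<le> \<tau> * \<rho> n" .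
    qed (use \<tau> in simp)
    also have "\<dots> = e / 2" using V C by (simp add: \<tau>_def V_def)
    also have "\<dots> < e" using \<open>e > 0\<close> by simp
    finally show "dist (conv d (iter_partial [i] (k n)) x) (v \<bullet> i) < e"
      by (simp add: dist_real_def del: iter_partial.simps)
  qed
qed

section \<open>Elementary facts on the distance function and on test functions\<close>

lemma
  shows bdist_lipschitz: "\<bar>bdist \<Omega> x - bdist \<Omega> y\<bar> \<le> norm (x - y)"
    and bdist_continuous: "continuous_on S (bdist \<Omega>)"
    and bdist_cball_subset: "\<rho> < bdist \<Omega> x \<Longrightarrow> cball x \<rho> \<subseteq> \<Omega>"
    and bdist_eq_0: "x \<notin> \<Omega> \<Longrightarrow> bdist \<Omega> x = 0"
    and bdist_pos: "open \<Omega> \<Longrightarrow> \<Omega> \<noteq> UNIV \<Longrightarrow> x \<in> \<Omega> \<Longrightarrow> bdist \<Omega> x > 0"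
proof -
  show "\<bar>bdist \<Omega> x - bdist \<Omega> y\<bar> \<le> norm (x - y)"
    using infdist_triangle_abs[of x "- \<Omega>" y] by (simp add: bdist_def dist_norm)
  show "continuous_on S (bdist \<Omega>)"
    unfolding bdist_def by (intro continuous_intros continuous_on_infdist)
  show "cball x \<rho> \<subseteq> \<Omega>" if "\<rho> < bdist \<Omega> x"
  proof
    fix y assume "y \<in> cball x \<rho>"
    then show "y \<in> \<Omega>"
      using infdist_le[of y "- \<Omega>" x] that by (cases "y \<in> \<Omega>") (auto simp: bdist_def)
  qed
  show "bdist \<Omega> x = 0" if "x \<notin> \<Omega>"
    using that by (simp add: bdist_def)
  show "bdist \<Omega> x > 0" if "open \<Omega>" "\<Omega> \<noteq> UNIV" "x \<in> \<Omega>"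
    unfolding bdist_def using that by (intro infdist_pos_not_in_closed) auto
qed

lemma
  assumes u: "test_fun \<Omega> u" and sub: "set is \<subseteq> Basis"
  shows test_fun_continuous: "continuous_on S (iter_partial is u)"
    and test_fun_support: "x \<notin> tsupport u \<Longrightarrow> iter_partial is u x = 0"
    and test_fun_has_partial: "i \<in> Basis \<Longrightarrow> has_partial (iter_partial is u) i (iter_partial (i # is) u)"
proof -
  show "continuous_on S (iter_partial is u)"
    "i \<in> Basis \<Longrightarrow> has_partial (iter_partial is u) i (iter_partial (i # is) u)"
    using u sub by (auto simp: test_fun_def simp del: iter_partial.simps
        intro: smooth_on_continuous smooth_on_has_partial)
  have 0: "u y = 0" if "y \<in> - tsupport u" for y
  proof (rule ccontr)
    assume "u y \<noteq> 0"
    then have "y \<in> closure {x. u x \<noteq> 0}"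
      by (intro subsetD[OF closure_subset]) simp
    with that show False by (simp add: tsupport_def)
  qed
  have "open (- tsupport u)"
    by (simp add: tsupport_def open_Compl)
  then show "x \<notin> tsupport u \<Longrightarrow> iter_partial is u x = 0"
    by (rule iter_partial_eq_0[OF _ 0]) simp_all
qed

lemma grad_inner_Basis: "i \<in> Basis \<Longrightarrow> grad u x \<bullet> i = iter_partial [i] u x"
  unfolding grad_def by (rule inner_sum_left_Basis)

lemma
  assumes u: "test_fun \<Omega> u"
  shows grad_continuous: "continuous_on S (grad u)"
    and grad_support: "x \<notin> tsupport u \<Longrightarrow> grad u x = 0"
proof -
  show "continuous_on S (grad u)"
    unfolding grad_def
    by (intro continuous_on_sum continuous_on_scaleR continuous_on_const test_fun_continuous[OF u]) auto
  show "x \<notin> tsupport u \<Longrightarrow> grad u x = 0"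
    unfolding grad_def by (intro sum.neutral) (simp add: test_fun_support[OF u] del: iter_partial.simps)
qed

section \<open>Passage to the limit\<close>

text \<open>The inequality for a general weight: \<open>h\<close> multiplies the gradient and
  \<open>- h'\<close> the function itself. The strict inequality \<open>R < T\<close> keeps R, a
  value that the distance may attain, in the interior of the interval where \<open>h\<close> is
  differentiable.\<close>

lemma weighted_hardy_inequality:
  fixes \<Omega> :: "'a::euclidean_space set"
  assumes \<Omega>: "open \<Omega>" "\<Omega> \<noteq> UNIV" and sh: "distr_superharmonic \<Omega> (bdist \<Omega>)"
    and u: "test_fun \<Omega> u" and R: "\<And>x. x \<in> \<Omega> \<Longrightarrow> bdist \<Omega> x \<le> R" "R < T"
    and h: "\<And>t. 0 < t \<Longrightarrow> t < T \<Longrightarrow> (h has_real_derivative h' t) (at t)" "continuous_on {0<..<T} h'"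
      "\<And>t. 0 < t \<Longrightarrow> t \<le> R \<Longrightarrow> h t \<ge> 0"
  shows "(LINT x|lborel. \<bar>u x\<bar> * - h' (bdist \<Omega> x)) \<le> (LINT x|lborel. norm (grad u x) * h (bdist \<Omega> x))"
proof -
  define d where "d = bdist \<Omega>"
  define K where "K = tsupport u"
  have K: "compact K" "K \<subseteq> \<Omega>"
    using u by (auto simp: K_def test_fun_def)
  have contd: "continuous_on S d" for S
    unfolding d_def by (rule bdist_continuous)
  have dR: "d x \<le> R" if "x \<in> \<Omega>" for x
    using R(1)[OF that] by (simp add: d_def)
  have dL: "\<bar>d x - d y\<bar> \<le> norm (x - y)" for x y
    unfolding d_def by (rule bdist_lipschitz)
  have dpos: "d x > 0" if "x \<in> K" for x
    using bdist_pos[OF \<Omega>, of x] that K(2) by (auto simp: d_def)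
  \<comment> \<open>The factor 2 leaves room for mollifying at radius at most \<open>c\<close>: the
    balls around points of \<open>K\<close> stay in \<open>\<Omega>\<close>, and \<open>D n\<close>
    takes values in [c, R] on \<open>K\<close>.\<close>
  obtain c where c: "c > 0" "\<And>x. x \<in> K \<Longrightarrow> 2 * c \<le> d x"
  proof (cases "K = {}")
    case True
    then show ?thesis using that[of 1] by simp
  next
    case False
    then obtain x0 where x0: "x0 \<in> K" "\<And>x. x \<in> K \<Longrightarrow> d x0 \<le> d x"
      using continuous_attains_inf[OF K(1) False contd] by blast
    then show ?thesis using that[of "d x0 / 2"] dpos[of x0] by simp
  qed

  obtain C where C: "C > 0" "\<And>\<rho>. \<rho> > 0 \<Longrightarrow> \<exists>k::'a \<Rightarrow> real. mollifier k \<rho> C"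
    by (rule exists_mollifier) blast
  define \<rho> where "\<rho> n = c / real (Suc n)" for n
  have \<rho>: "\<rho> n > 0" "\<rho> n \<le> c" for n
    using c(1) by (auto simp: \<rho>_def field_simps)
  have \<rho>0: "\<rho> \<longlonglongrightarrow> 0"
    unfolding \<rho>_def by (intro LIMSEQ_Suc lim_const_over_n)
  have "\<exists>k::nat \<Rightarrow> 'a \<Rightarrow> real. \<forall>n. mollifier (k n) (\<rho> n) C"
    by (rule choice) (use C(2) \<rho>(1) in blast)
  then obtain k :: "nat \<Rightarrow> 'a \<Rightarrow> real" where k: "\<And>n. mollifier (k n) (\<rho> n) C"
    by blast
  define D where "D n = conv d (k n)" for n
  define P where "P n i = conv d (iter_partial [i] (k n))" for n i
  define v where "v n x = (\<Sum>i\<in>Basis. P n i x *\<^sub>R i)" for n x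
  have sub: "cball x (\<rho> n) \<subseteq> \<Omega>" if "x \<in> K" for x n
  proof (rule bdist_cball_subset)
    show "\<rho> n < bdist \<Omega> x" using c(1) c(2)[OF that] \<rho>(2)[of n] by (simp add: d_def)
  qed
  have Dge: "c \<le> D n x" and Dle: "D n x \<le> R" if "x \<in> K" for n x
  proof -
    show "c \<le> D n x"
      unfolding D_def
    proof (rule conv_mollifier_ge[OF k contd])
      fix y :: 'a assume "norm y \<le> \<rho> n"
      then show "c \<le> d (x - y)" using dL[of x "x - y"] c(2)[OF that] \<rho>(2)[of n] by simp
    qed
    show "D n x \<le> R"
      unfolding D_def
    proof (rule conv_mollifier_le[OF k contd])
      fix y :: 'a assume "norm y \<le> \<rho> n"
      then have "x - y \<in> cball x (\<rho> n)" by (simp add: dist_norm)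
      then show "d (x - y) \<le> R" using sub[OF that] dR by blast
    qed
  qed
  have Dlim: "(\<lambda>n. D n x) \<longlonglongrightarrow> d x" for x
  proof (rule tendsto_sandwich[OF always_eventually always_eventually])
    show "\<forall>n. d x - \<rho> n \<le> D n x"
      unfolding D_def
    proof (intro allI conv_mollifier_ge[OF k contd])
      fix n and y :: 'a assume "norm y \<le> \<rho> n"
      then show "d x - \<rho> n \<le> d (x - y)" using dL[of x "x - y"] by simp
    qed
    show "\<forall>n. D n x \<le> d x + \<rho> n"
      unfolding D_def
    proof (intro allI conv_mollifier_le[OF k contd])
      fix n and y :: 'a assume "norm y \<le> \<rho> n"
      then show "d (x - y) \<le> d x + \<rho> n" using dL[of x "x - y"] by simp
    qed
    show "(\<lambda>n. d x - \<rho> n) \<longlonglongrightarrow> d x"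
      using tendsto_diff[OF tendsto_const \<rho>0, of "d x"] by simp
    show "(\<lambda>n. d x + \<rho> n) \<longlonglongrightarrow> d x"
      using tendsto_add[OF tendsto_const \<rho>0, of "d x"] by simp
  qed
  have contD: "continuous_on S (D n)" for S n
    using conv_mollifier_continuous[OF k contd, of "[]"] unfolding D_def by simp
  have contP: "continuous_on S (P n i)" if "i \<in> Basis" for S n i
    unfolding P_def using that by (intro conv_mollifier_continuous[OF k contd]) simp
  have contv: "continuous_on S (v n)" for S n
    unfolding v_def[abs_def] by (intro continuous_on_sum continuous_on_scaleR continuous_on_const contP)
  have v_Basis: "v n x \<bullet> i = P n i x" if "i \<in> Basis" for n x i
    unfolding v_def using that by (rule inner_sum_left_Basis)

  define V where "V = C * measure lborel (ball (0::'a) 1)"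
  \<comment> \<open>The approximation estimate with v = 0 and tau = 1, by the Lipschitz bound for
    \<open>d\<close>. It is uniform in \<open>n\<close> and supplies the majorants below.\<close>
  have Pbound: "\<bar>P n i x\<bar> \<le> V" if "i \<in> Basis" for n i x
  proof -
    have "\<bar>conv d (iter_partial [i] (k n)) x - 0 \<bullet> i\<bar> \<le> 1 * C * measure lborel (ball (0::'a) 1)"
    proof (rule conv_mollifier_partial_approx[OF k \<rho>(1) contd that])
      fix y :: 'a assume "norm y \<le> \<rho> n"
      then show "\<bar>d (x - y) - d x + 0 \<bullet> y\<bar> \<le> 1 * \<rho> n" using dL[of "x - y" x] by simp
    qed simp
    then show ?thesis by (simp only: V_def P_def inner_zero_left diff_zero mult_1)
  qed
  define Q where "Q = real (DIM('a)) * V"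
  have vbound: "norm (v n x) \<le> Q" for n x
  proof -
    have "norm (v n x) \<le> (\<Sum>i\<in>Basis. \<bar>v n x \<bullet> i\<bar>)" by (rule norm_le_l1)
    also have "\<dots> \<le> (\<Sum>i\<in>(Basis::'a set). V)"
      by (intro sum_mono) (simp add: v_Basis Pbound)
    finally show ?thesis by (simp add: Q_def)
  qed
  have "V \<ge> 0" using C(1) by (simp add: V_def)
  then have "Q \<ge> 0" by (simp add: Q_def)
  have "AE x in lborel. x \<notin> - \<Omega> \<longrightarrow>
      (\<exists>n. norm n = 1 \<and> ((\<lambda>z. infdist z (- \<Omega>)) has_derivative (\<lambda>v. n \<bullet> v)) (at x))"
    using \<Omega> by (intro AE_infdist_has_derivative) auto
  \<comment> \<open>Wherever \<open>d\<close> is differentiable, the mollified gradients converge to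
    its gradient, which has norm 1.\<close>
  then have vlim: "AE x in lborel. x \<in> \<Omega> \<longrightarrow> (\<lambda>n. norm (v n x)) \<longlonglongrightarrow> 1"
  proof eventually_elim
    case (elim x)
    show ?case
    proof
      assume "x \<in> \<Omega>"
      then obtain w where w: "norm w = 1" "(d has_derivative (\<lambda>y. w \<bullet> y)) (at x)"
        using elim unfolding d_def bdist_def by auto
      have "(\<lambda>n. P n i x) \<longlonglongrightarrow> w \<bullet> i" if "i \<in> Basis" for i
        unfolding P_def by (rule conv_mollifier_partial_tendsto[OF k \<rho>(1) \<rho>0 contd w(2) that C(1)])
      then have "(\<lambda>n. v n x) \<longlonglongrightarrow> (\<Sum>i\<in>Basis. (w \<bullet> i) *\<^sub>R i)"
        unfolding v_def by (intro tendsto_sum tendsto_scaleR tendsto_const)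
      then have "(\<lambda>n. norm (v n x)) \<longlonglongrightarrow> norm w"
        unfolding euclidean_representation by (rule tendsto_norm)
      then show "(\<lambda>n. norm (v n x)) \<longlonglongrightarrow> 1" by (simp only: w(1))
    qed
  qed

  define \<delta> where "\<delta> n = 1 / real (Suc n)" for n
  have \<delta>: "\<delta> n > 0" for n by (simp add: \<delta>_def)
  have \<delta>0: "\<delta> \<longlonglongrightarrow> 0" unfolding \<delta>_def by (intro LIMSEQ_Suc lim_const_over_n)
  \<comment> \<open>A smooth substitute for |u|: it lies between 0 and |u|, vanishes where u does,
    and its gradient is that of u times a factor of absolute value below 1.\<close>
  define b where "b n x = sqrt ((u x)\<^sup>2 + (\<delta> n)\<^sup>2) - \<delta> n" for n x
  define bi where "bi n i x = u x / sqrt ((u x)\<^sup>2 + (\<delta> n)\<^sup>2) * iter_partial [i] u x" for n i x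
  have pos: "(u x)\<^sup>2 + (\<delta> n)\<^sup>2 > 0" for n x
    using \<delta>[of n] by (simp add: add_nonneg_pos)
  have u0: "u x = 0" "iter_partial [i] u x = 0" "grad u x = 0" if "x \<notin> K" "i \<in> Basis" for x i
    using that test_fun_support[OF u, of "[]" x] test_fun_support[OF u, of "[i]" x] grad_support[OF u, of x]
    by (simp_all add: K_def del: iter_partial.simps(2))
  have Basis_ex: "\<exists>i::'a. i \<in> Basis" using nonempty_Basis by blast
  have contu: "continuous_on S u" and contui: "i \<in> Basis \<Longrightarrow> continuous_on S (iter_partial [i] u)" for S i
    using test_fun_continuous[OF u, of "[]" S] test_fun_continuous[OF u, of "[i]" S] by simp_all
  have b_le: "0 \<le> b n x" "b n x \<le> \<bar>u x\<bar>" for n x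
  proof -
    have "sqrt ((\<delta> n)\<^sup>2) \<le> sqrt ((u x)\<^sup>2 + (\<delta> n)\<^sup>2)" by (rule real_sqrt_le_mono) simp
    then show "0 \<le> b n x" using \<delta>[of n] by (simp add: b_def)
    show "b n x \<le> \<bar>u x\<bar>"
      using sqrt_add_le_add_sqrt[of "(u x)\<^sup>2" "(\<delta> n)\<^sup>2"] \<delta>[of n] by (simp add: b_def)
  qed
  have contb: "continuous_on S (b n)" for S n
    unfolding b_def[abs_def] by (intro continuous_intros contu)
  have blim: "(\<lambda>n. b n x) \<longlonglongrightarrow> \<bar>u x\<bar>" for x
  proof -
    have "(\<lambda>n. b n x) \<longlonglongrightarrow> sqrt ((u x)\<^sup>2 + 0\<^sup>2) - 0"
      unfolding b_def by (intro tendsto_intros \<delta>0)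
    then show ?thesis by simp
  qed

  have conth: "continuous_on {0<..<T} h"
    by (rule DERIV_continuous_on[of _ h h']) (rule has_field_derivative_at_within, rule h(1), auto)
  have cR: "{c..R} \<subseteq> {0<..<T}" using c(1) R(2) by auto
  \<comment> \<open>On \<open>K\<close> all values of \<open>D n\<close> lie in the compact interval
    [c, R], so \<open>h\<close> and \<open>h'\<close> are bounded there uniformly in
    \<open>n\<close>.\<close>
  obtain Bh where Bh: "\<And>t. t \<in> {c..R} \<Longrightarrow> \<bar>h t\<bar> \<le> Bh"
    using compact_imp_bounded[OF compact_continuous_image[OF continuous_on_subset[OF conth cR] compact_Icc]]
    unfolding bounded_iff ball_simps real_norm_def by blast
  obtain Bh' where Bh': "\<And>t. t \<in> {c..R} \<Longrightarrow> \<bar>h' t\<bar> \<le> Bh'"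
    using compact_imp_bounded[OF compact_continuous_image[OF continuous_on_subset[OF h(2) cR] compact_Icc]]
    unfolding bounded_iff ball_simps real_norm_def by blast
  have uK: "u x = 0" "grad u x = 0" if "x \<notin> K" for x
    using u0(1,3)[OF that] Basis_ex by blast+
  have bK: "b n x = 0" if "x \<notin> K" for n x
    using b_le[of n x] uK(1)[OF that] by simp
  obtain Um where Um: "Um > 0" "\<And>x. \<bar>u x\<bar> \<le> Um"
    using bounded_compact_support[OF K(1) contu uK(1)] by blast
  have "continuous_on K (\<lambda>x. norm (grad u x))"
    by (intro continuous_on_norm grad_continuous[OF u])
  then obtain Gm where Gm: "Gm > 0" "\<And>x. \<bar>norm (grad u x)\<bar> \<le> Gm"
    using bounded_compact_support[OF K(1), of "\<lambda>x. norm (grad u x)"] uK(2) norm_zero by metis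

  have contK: "continuous_on K (\<lambda>x. f (D n x))" "continuous_on K (\<lambda>x. f (d x))"
    if "continuous_on {0<..<T} f" for f n
  proof -
    show "continuous_on K (\<lambda>x. f (D n x))"
      using Dge Dle cR by (intro continuous_on_compose2[OF that contD]) force
    have "d x \<in> {c..R}" if "x \<in> K" for x
      using c(1) c(2)[OF that] dR[of x] that K(2) by auto
    then show "continuous_on K (\<lambda>x. f (d x))"
      using cR by (intro continuous_on_compose2[OF that contd]) blast
  qed

  define H where "H n x = b n x * (- h' (D n x) * (norm (v n x))\<^sup>2)" for n x
  define G where "G n x = norm (grad u x) * (h (D n x) * norm (v n x))" for n x
  have intH: "integrable lborel (H n)" and intG: "integrable lborel (G n)" for n
  proof -
    show "integrable lborel (H n)"
      unfolding H_def[abs_def]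
      by (intro integrable_compact_support[OF K(1)] continuous_on_mult continuous_on_minus continuous_on_power
          continuous_on_norm contK h(2) contb contv) (simp add: bK)
    show "integrable lborel (G n)"
      unfolding G_def[abs_def]
      by (intro integrable_compact_support[OF K(1)] continuous_on_mult
          continuous_on_norm contK conth grad_continuous[OF u] contv) (simp add: uK)
  qed
  have step: "(LINT x|lborel. H n x) \<le> (LINT x|lborel. G n x)" for n
  proof -
    have normv: "(norm (v n x))\<^sup>2 = (\<Sum>i\<in>Basis. (P n i x)\<^sup>2)" for x
      unfolding power2_norm_eq_inner
      by (subst euclidean_inner) (simp add: v_Basis power2_eq_square)
    have "(LINT x|lborel. b n x * (- h' (D n x) * (\<Sum>i\<in>Basis. (P n i x)\<^sup>2))) \<le>
        (LINT x|lborel. (\<Sum>i\<in>Basis. bi n i x * (h (D n x) * P n i x)))"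
    proof (rule divergence_inequality[OF K(1), where T = T and Dii = "\<lambda>i. conv d (iter_partial [i, i] (k n))"])
      fix i :: 'a assume i: "i \<in> Basis"
      show "continuous_on UNIV (P n i)" by (rule contP[OF i])
      show "continuous_on UNIV (conv d (iter_partial [i, i] (k n)))"
        using i by (intro conv_mollifier_continuous[OF k contd]) simp
      show "has_partial (D n) i (P n i)"
        using conv_mollifier_has_partial[OF k contd, of "[]" i n] i unfolding D_def P_def by simp
      show "has_partial (P n i) i (conv d (iter_partial [i, i] (k n)))"
        unfolding P_def using i by (intro conv_mollifier_has_partial[OF k contd]) simp_all
      show "continuous_on UNIV (bi n i)"
        unfolding bi_def[abs_def] using pos[THEN less_imp_neq]
        by (intro continuous_intros contu contui i) (metis real_sqrt_eq_zero_cancel_iff)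
      show "has_partial (b n) i (bi n i)"
        unfolding has_partial_def
      proof
        fix x
        have "((\<lambda>t. u (x + t *\<^sub>R i)) has_real_derivative iter_partial [i] u x) (at 0)"
          using test_fun_has_partial[OF u, of "[]" i] i by (simp add: has_partial_def)
        then show "((\<lambda>t. b n (x + t *\<^sub>R i)) has_real_derivative bi n i x) (at 0)"
          unfolding b_def bi_def using pos[of x n]
          by (auto intro!: derivative_eq_intros simp: field_simps simp del: iter_partial.simps)
      qed
      show "bi n i x = 0" if "x \<notin> K" for x
        using u0(1)[OF that i] by (simp add: bi_def)
    next
      fix x assume x: "x \<in> K"
      show "(\<Sum>i\<in>Basis. conv d (iter_partial [i, i] (k n)) x) \<le> 0"
        using sh bdist_eq_0[of _ \<Omega>] unfolding d_def[symmetric]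
        by (intro conv_superharmonic[OF _ contd _ k sub[OF x]]) auto
      show "0 < D n x" "D n x < T" "h (D n x) \<ge> 0"
        using Dge[OF x, of n] Dle[OF x, of n] c(1) R(2) h(3)[of "D n x"] by auto
    qed (use contD contb b_le(1) h(1,2) bK in simp_all)
    \<comment> \<open>Cauchy-Schwarz for the gradients of u and D; the factor u / sqrt(u^2 +
      delta^2) has absolute value at most 1, and h >= 0 preserves the direction of the
      estimate.\<close>
    also have "\<dots> \<le> (LINT x|lborel. G n x)"
    proof (rule integral_mono'[OF intG])
      fix x
      show "(\<Sum>i\<in>Basis. bi n i x * (h (D n x) * P n i x)) \<le> G n x" "0 \<le> G n x"
      proof (atomize (full), cases "x \<in> K")
        case True
        define q where "q = u x / sqrt ((u x)\<^sup>2 + (\<delta> n)\<^sup>2)"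
        have "\<bar>u x\<bar> \<le> sqrt ((u x)\<^sup>2 + (\<delta> n)\<^sup>2)"
          using real_sqrt_le_mono[of "(u x)\<^sup>2" "(u x)\<^sup>2 + (\<delta> n)\<^sup>2"] by simp
        then have q: "\<bar>q\<bar> \<le> 1"
          using pos[of x n] by (simp add: q_def field_simps)
        have hD: "h (D n x) \<ge> 0"
          using Dge[OF True, of n] Dle[OF True, of n] c(1) h(3)[of "D n x"] by auto
        have "(\<Sum>i\<in>Basis. bi n i x * (h (D n x) * P n i x)) = h (D n x) * (q * (grad u x \<bullet> v n x))"
          by (subst euclidean_inner)
            (simp add: bi_def q_def v_Basis grad_inner_Basis sum_distrib_left sum_divide_distrib mult_ac del: iter_partial.simps)
        also have "\<dots> \<le> h (D n x) * (1 * (norm (grad u x) * norm (v n x)))"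
        proof (rule mult_left_mono[OF _ hD])
          have "\<bar>q * (grad u x \<bullet> v n x)\<bar> \<le> 1 * (norm (grad u x) * norm (v n x))"
            unfolding abs_mult by (intro mult_mono q Cauchy_Schwarz_ineq2) auto
          then show "q * (grad u x \<bullet> v n x) \<le> 1 * (norm (grad u x) * norm (v n x))" by linarith
        qed
        finally show "(\<Sum>i\<in>Basis. bi n i x * (h (D n x) * P n i x)) \<le> G n x \<and> 0 \<le> G n x"
          using hD by (simp add: G_def mult_ac)
      next
        case False
        have "bi n i x = 0" if "i \<in> Basis" for i
          using u0(1)[OF False that] by (simp add: bi_def)
        moreover have "G n x = 0"
          using uK(2)[OF False] by (simp add: G_def)
        ultimately show "(\<Sum>i\<in>Basis. bi n i x * (h (D n x) * P n i x)) \<le> G n x \<and> 0 \<le> G n x"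
          by simp
      qed
    qed
    finally show ?thesis by (simp only: H_def normv)
  qed
  have limh: "(\<lambda>n. h (D n x)) \<longlonglongrightarrow> h (d x)" "(\<lambda>n. h' (D n x)) \<longlonglongrightarrow> h' (d x)" if "x \<in> K" for x
  proof -
    have "d x \<in> {0<..<T}"
      using dpos[OF that] dR[of x] that K(2) R(2) by auto
    then have "isCont h (d x)" "isCont h' (d x)"
      using conth h(2) by (auto simp: continuous_on_eq_continuous_at)
    then show "(\<lambda>n. h (D n x)) \<longlonglongrightarrow> h (d x)" "(\<lambda>n. h' (D n x)) \<longlonglongrightarrow> h' (d x)"
      using Dlim by (auto intro: isCont_tendsto_compose)
  qed
  \<comment> \<open>The limit 1 of the gradient norms is kept as a visible factor, so that the limit
    has the same product form as \<open>H n\<close>.\<close>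
  have "(\<lambda>n. LINT x|lborel. H n x) \<longlonglongrightarrow> (LINT x|lborel. \<bar>u x\<bar> * (- h' (d x) * 1\<^sup>2))"
  proof (rule integral_tendsto_compact_support[OF K(1), where M = "Um * (Bh' * Q\<^sup>2)"])
    show "H n \<in> borel_measurable lborel" for n
      by (rule borel_measurable_integrable[OF intH])
    have "integrable lborel (\<lambda>x. \<bar>u x\<bar> * (- h' (d x) * 1\<^sup>2))"
      by (intro integrable_compact_support[OF K(1)] continuous_on_mult continuous_on_minus
          continuous_on_const continuous_on_rabs contK h(2) contu) (simp add: uK)
    then show "(\<lambda>x. \<bar>u x\<bar> * (- h' (d x) * 1\<^sup>2)) \<in> borel_measurable lborel"
      by (rule borel_measurable_integrable)
    show "AE x in lborel. (\<lambda>n. H n x) \<longlonglongrightarrow> \<bar>u x\<bar> * (- h' (d x) * 1\<^sup>2)"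
      using vlim
    proof eventually_elim
      case (elim x)
      show ?case
      proof (cases "x \<in> K")
        case True
        then have "(\<lambda>n. norm (v n x)) \<longlonglongrightarrow> 1" using elim K(2) by blast
        then show ?thesis
          unfolding H_def by (intro tendsto_mult tendsto_minus tendsto_power blim limh(2)[OF True])
      next
        case False
        then show ?thesis by (simp add: H_def bK uK)
      qed
    qed
    fix n x
    show "\<bar>H n x\<bar> \<le> Um * (Bh' * Q\<^sup>2)" if x: "x \<in> K"
    proof -
      have "\<bar>b n x\<bar> \<le> Um" using b_le[of n x] Um(2)[of x] by linarith
      moreover have 1: "\<bar>- h' (D n x)\<bar> \<le> Bh'" using Bh'[of "D n x"] Dge[OF x] Dle[OF x] by simp
      moreover have "\<bar>(norm (v n x))\<^sup>2\<bar> \<le> Q\<^sup>2" using vbound[of n x] by (simp add: power_mono)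
      moreover have "0 \<le> Bh'" using 1 by linarith
      ultimately show ?thesis
        unfolding H_def abs_mult using Um(1) by (intro mult_mono) auto
    qed
    show "H n x = 0" if "x \<notin> K"
    using bK[OF that] by (simp add: H_def)
  qed
  moreover have "(\<lambda>n. LINT x|lborel. G n x) \<longlonglongrightarrow> (LINT x|lborel. norm (grad u x) * (h (d x) * 1))"
  proof (rule integral_tendsto_compact_support[OF K(1), where M = "Gm * (Bh * Q)"])
    show "G n \<in> borel_measurable lborel" for n
      by (rule borel_measurable_integrable[OF intG])
    have "integrable lborel (\<lambda>x. norm (grad u x) * (h (d x) * 1))"
      by (intro integrable_compact_support[OF K(1)] continuous_on_mult
          continuous_on_const continuous_on_norm contK conth grad_continuous[OF u]) (simp add: uK)
    then show "(\<lambda>x. norm (grad u x) * (h (d x) * 1)) \<in> borel_measurable lborel"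
      by (rule borel_measurable_integrable)
    show "AE x in lborel. (\<lambda>n. G n x) \<longlonglongrightarrow> norm (grad u x) * (h (d x) * 1)"
      using vlim
    proof eventually_elim
      case (elim x)
      show ?case
      proof (cases "x \<in> K")
        case True
        then have "(\<lambda>n. norm (v n x)) \<longlonglongrightarrow> 1" using elim K(2) by blast
        then show ?thesis
          unfolding G_def by (intro tendsto_mult tendsto_const limh(1)[OF True])
      next
        case False
        then show ?thesis by (simp add: G_def uK)
      qed
    qed
    fix n x
    show "\<bar>G n x\<bar> \<le> Gm * (Bh * Q)" if x: "x \<in> K"
    proof -
      have 1: "\<bar>h (D n x)\<bar> \<le> Bh" using Bh[of "D n x"] Dge[OF x] Dle[OF x] by simp
      then have "0 \<le> Bh" by linarith
      moreover have "\<bar>norm (v n x)\<bar> \<le> Q" using vbound[of n x] by simp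
      ultimately show ?thesis
        unfolding G_def abs_mult using 1 Gm \<open>Q \<ge> 0\<close> by (intro mult_mono) auto
    qed
    show "G n x = 0" if "x \<notin> K"
    using uK(2)[OF that] by (simp add: G_def)
  qed
  ultimately have "(LINT x|lborel. \<bar>u x\<bar> * (- h' (d x) * 1\<^sup>2)) \<le> (LINT x|lborel. norm (grad u x) * (h (d x) * 1))"
    using step by (intro LIMSEQ_le[of "\<lambda>n. LINT x|lborel. H n x" _ "\<lambda>n. LINT x|lborel. G n x"]) auto
  then show ?thesis by (simp add: d_def)
qed

section \<open>The weight of the theorem\<close>

text \<open>The function h of the overview, with X(t/R) powr (gamma - 1) written through 1 - ln
  (t/R).\<close>

definition hardy_weight :: "real \<Rightarrow> real \<Rightarrow> real \<Rightarrow> real \<Rightarrow> real" where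
  "hardy_weight R s \<gamma> t = t powr (1 - s) - R powr (1 - s) * (1 - ln (t / R)) powr (1 - \<gamma>)"

text \<open>Up to sign, the sum of the weights (s - 1) t^(-s) and (gamma - 1) R^(1-s) X(t/R)^gamma /
  t of the claimed inequality.\<close>

definition hardy_weight' :: "real \<Rightarrow> real \<Rightarrow> real \<Rightarrow> real \<Rightarrow> real" where
  "hardy_weight' R s \<gamma> t =
    - (s - 1) * t powr (- s) - R powr (1 - s) * ((\<gamma> - 1) * (1 - ln (t / R)) powr (- \<gamma>) / t)"

text \<open>X(t/R) blows up only at t = R e, beyond R, so the weight stays smooth across t =
  R.\<close>

lemma one_minus_ln_pos:
  fixes R t :: real
  assumes "R > 0" "0 < t" "t < R * exp 1"
  shows "1 - ln (t / R) > 0"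
proof -
  have "t / R < exp 1" using assms by (simp add: field_simps)
  then have "ln (t / R) < ln (exp 1)" using assms by (subst ln_less_cancel_iff) auto
  then show ?thesis by simp
qed

lemma hardy_weight_has_derivative:
  assumes "R > 0" "0 < t" "t < R * exp 1"
  shows "(hardy_weight R s \<gamma> has_real_derivative hardy_weight' R s \<gamma> t) (at t)"
proof -
  have 1: "((\<lambda>t. t powr (1 - s)) has_real_derivative (1 - s) * t powr (1 - s - 1)) (at t)"
    using assms(2) by (rule has_real_derivative_powr)
  have 2: "((\<lambda>t. 1 - ln (t / R)) has_real_derivative - (1 / t)) (at t)"
    using assms by (auto intro!: derivative_eq_intros)
  have 3: "((\<lambda>t. (1 - ln (t / R)) powr (1 - \<gamma>)) has_real_derivative
      ((1 - \<gamma>) * (1 - ln (t / R)) powr (1 - \<gamma> - 1)) * - (1 / t)) (at t)"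
    by (rule DERIV_chain2[OF has_real_derivative_powr[OF one_minus_ln_pos[OF assms]] 2])
  have "((\<lambda>t. t powr (1 - s) - R powr (1 - s) * (1 - ln (t / R)) powr (1 - \<gamma>)) has_real_derivative
      (1 - s) * t powr (1 - s - 1) -
      R powr (1 - s) * (((1 - \<gamma>) * (1 - ln (t / R)) powr (1 - \<gamma> - 1)) * - (1 / t))) (at t)"
    by (intro DERIV_diff DERIV_cmult 1 3)
  moreover have "(1 - s) * t powr (1 - s - 1) -
      R powr (1 - s) * (((1 - \<gamma>) * (1 - ln (t / R)) powr (1 - \<gamma> - 1)) * - (1 / t)) = hardy_weight' R s \<gamma> t"
    using assms(2) by (simp add: hardy_weight'_def field_simps)
  ultimately show ?thesis by (simp add: hardy_weight_def[abs_def])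
qed

lemma continuous_hardy_weight':
  assumes "R > 0"
  shows "continuous_on {0<..<R * exp 1} (hardy_weight' R s \<gamma>)"
  unfolding hardy_weight'_def[abs_def]
proof (intro continuous_on_diff continuous_on_mult continuous_on_const continuous_on_powr
    continuous_on_divide continuous_on_ln continuous_on_id ballI)
  fix t assume "t \<in> {0<..<R * exp 1}"
  then show "1 - ln (t / R) \<noteq> 0" using one_minus_ln_pos[OF assms, of t] by auto
qed (use assms in auto)

text \<open>For t <= R one has X(t/R) <= 1, so the subtracted term is at most R^(1-s), which is at
  most t^(1-s) because the exponent is nonpositive.\<close>

lemma hardy_weight_nonneg:
  assumes "0 < t" "t \<le> R" "s \<ge> 1" "\<gamma> > 1"
  shows "hardy_weight R s \<gamma> t \<ge> 0"
proof -
  have "R > 0" using assms(1,2) by linarith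
  then have "ln (t / R) \<le> ln 1" using assms(1,2) by (subst ln_le_cancel_iff) auto
  then have "(1 - ln (t / R)) powr (1 - \<gamma>) \<le> 1 powr (1 - \<gamma>)"
    using assms(4) by (intro powr_mono2') auto
  then have "R powr (1 - s) * (1 - ln (t / R)) powr (1 - \<gamma>) \<le> R powr (1 - s) * 1"
    by (intro mult_left_mono) auto
  also have "\<dots> \<le> t powr (1 - s)"
    using assms(1-3) by (simp add: powr_mono2')
  finally show ?thesis by (simp add: hardy_weight_def)
qed

theorem theorem2p11:
  fixes \<Omega> :: "'a::euclidean_space set" and s \<gamma> :: real
  assumes "open \<Omega>" and "\<Omega> \<noteq> UNIV"
    and "distr_superharmonic \<Omega> (bdist \<Omega>)"
    and "bdd_above (bdist \<Omega> ` \<Omega>)"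
    and "s \<ge> 1" and "\<gamma> > 1"
  shows "\<exists>C\<ge>\<gamma> - 1. \<forall>u. test_fun \<Omega> u \<longrightarrow>
    (let d = bdist \<Omega>; R = (SUP x\<in>\<Omega>. bdist \<Omega> x) in
      (LINT x:\<Omega>|lebesgue. norm (grad u x) / d x powr (s - 1))
      \<ge> (s - 1) * (LINT x:\<Omega>|lebesgue. \<bar>u x\<bar> / d x powr s)
        + C / R powr (s - 1) * (LINT x:\<Omega>|lebesgue. \<bar>u x\<bar> / d x * Xf (d x / R) powr \<gamma>))"
\<comment> \<open>The witness is the factor produced by differentiating X powr (gamma - 1); it is
  the same for all \<open>u\<close>.\<close>
proof (rule exI[of _ "\<gamma> - 1"], intro conjI order_refl allI impI)
  fix u assume u: "test_fun \<Omega> u"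
  define d where "d = bdist \<Omega>"
  define R where "R = (SUP x\<in>\<Omega>. bdist \<Omega> x)"
  define K where "K = tsupport u"
  have K: "compact K" "K \<subseteq> \<Omega>"
    using u by (auto simp: K_def test_fun_def)
  have dR: "d x \<le> R" if "x \<in> \<Omega>" for x
    unfolding R_def d_def using assms(4) that by (rule cSUP_upper2[OF _ _ order_refl])
  have dpos: "0 < d x" if "x \<in> \<Omega>" for x
    unfolding d_def using assms(1,2) that by (rule bdist_pos)
  have uK: "u x = 0" "grad u x = 0" if "x \<notin> K" for x
    using that test_fun_support[OF u, of "[]" x] grad_support[OF u, of x] by (simp_all add: K_def)
  define f1 where "f1 x = norm (grad u x) / d x powr (s - 1)" for x
  define f2 where "f2 x = \<bar>u x\<bar> / d x powr s" for x
  define f3 where "f3 x = \<bar>u x\<bar> / d x * Xf (d x / R) powr \<gamma>" for x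
  have "(s - 1) * (LINT x:\<Omega>|lebesgue. f2 x) + (\<gamma> - 1) / R powr (s - 1) * (LINT x:\<Omega>|lebesgue. f3 x)
    \<le> (LINT x:\<Omega>|lebesgue. f1 x)"
  proof (cases "\<Omega> = {}")
    \<comment> \<open>Here \<open>R\<close> is a supremum over the empty set, so the case is settled
      by the vanishing of all integrals.\<close>
    case True
    then show ?thesis by (simp add: set_lebesgue_integral_def)
  next
    case False
    then have R: "R > 0" using dpos dR by (meson all_not_in_conv less_le_trans)
    \<comment> \<open>\<open>R * exp 1\<close> serves as the endpoint \<open>T\<close>: it exceeds
      R, and the weight is differentiable below it.\<close>
    have T: "R < R * exp 1" using R by simp
    have dK: "d x \<in> {0<..<R * exp 1}" "d x > 0" if "x \<in> K" for x
    proof -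
      have "x \<in> \<Omega>" using that K(2) by blast
      then show "d x > 0" "d x \<in> {0<..<R * exp 1}"
        using dpos[of x] dR[of x] T by (auto intro: le_less_trans)
    qed
    have contd: "continuous_on K d" unfolding d_def by (rule bdist_continuous)
    have contu: "continuous_on K u"
      using test_fun_continuous[OF u, of "[]" K] by simp
    have ln: "1 - ln (d x / R) > 0" if "x \<in> K" for x
      using dK[OF that] R by (intro one_minus_ln_pos) auto
    have int1: "integrable lborel f1"
      unfolding f1_def[abs_def]
      by (intro integrable_compact_support[OF K(1)] continuous_on_divide continuous_on_norm
          grad_continuous[OF u] continuous_on_powr contd continuous_on_const ballI)
        (use dK uK in force)+
    have int2: "integrable lborel f2"
      unfolding f2_def[abs_def]
      by (intro integrable_compact_support[OF K(1)] continuous_on_divide continuous_on_rabs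
          contu continuous_on_powr contd continuous_on_const ballI)
        (use dK uK in force)+
    have int3: "integrable lborel f3"
    proof (rule integrable_compact_support[OF K(1)])
      have "continuous_on K (\<lambda>x. ln (d x / R))"
        using dK(2) R by (intro continuous_on_ln continuous_on_divide contd continuous_on_const) force+
      then show "continuous_on K f3"
        unfolding f3_def[abs_def] Xf_def
        by (intro continuous_on_mult continuous_on_divide continuous_on_rabs contu contd
            continuous_on_powr continuous_on_diff continuous_on_const ballI)
          (use dK(2) ln in force)+
    qed (simp add: f3_def uK)
    let ?h = "hardy_weight R s \<gamma>" and ?h' = "hardy_weight' R s \<gamma>"
    \<comment> \<open>A pointwise identity: \<open>- ?h' (d x)\<close> is the sum of the two weights
      on \<open>K\<close>, and off \<open>K\<close> both sides vanish with \<open>u\<close>.\<close>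
    have "(LINT x|lborel. (s - 1) * f2 x + (\<gamma> - 1) / R powr (s - 1) * f3 x) =
        (LINT x|lborel. \<bar>u x\<bar> * - ?h' (d x))"
    proof (rule Bochner_Integration.integral_cong[OF refl])
      fix x
      show "(s - 1) * f2 x + (\<gamma> - 1) / R powr (s - 1) * f3 x = \<bar>u x\<bar> * - ?h' (d x)"
      proof (cases "x \<in> K")
        case True
        have eqs: "R powr (1 - s) = 1 / R powr (s - 1)" "d x powr (- s) = 1 / d x powr s"
          using powr_minus_divide[of R "s - 1"] by (simp_all add: powr_minus_divide)
        have X: "Xf (d x / R) powr \<gamma> = (1 - ln (d x / R)) powr (- \<gamma>)"
          using ln[OF True] by (simp add: Xf_def powr_divide powr_minus_divide)
        show ?thesis
          unfolding f2_def f3_def hardy_weight'_def eqs X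
          using dK(2)[OF True] R by (simp add: field_simps)
      qed (simp add: f2_def f3_def uK)
    qed
    also have "\<dots> \<le> (LINT x|lborel. norm (grad u x) * ?h (d x))"
      unfolding d_def
    proof (rule weighted_hardy_inequality[OF assms(1-3) u])
      show "\<And>x. x \<in> \<Omega> \<Longrightarrow> bdist \<Omega> x \<le> R" using dR by (simp add: d_def)
      show "\<And>t. 0 < t \<Longrightarrow> t \<le> R \<Longrightarrow> 0 \<le> ?h t"
        using assms(5,6) by (intro hardy_weight_nonneg)
    qed (use R T in \<open>auto intro: hardy_weight_has_derivative continuous_hardy_weight'\<close>)
    \<comment> \<open>Dropping the nonnegative subtracted term of the weight leaves d^(1-s).\<close>
    also have "\<dots> \<le> (LINT x|lborel. f1 x)"
    proof (rule integral_mono'[OF int1])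
      fix x
      show "norm (grad u x) * ?h (d x) \<le> f1 x"
      proof -
        have "?h (d x) \<le> 1 / d x powr (s - 1)"
          using powr_minus_divide[of "d x" "s - 1"] by (simp add: hardy_weight_def)
        then show ?thesis
          using mult_left_mono[OF _ norm_ge_zero[of "grad u x"]] by (force simp: f1_def)
      qed
      show "0 \<le> f1 x" by (simp add: f1_def)
    qed
    finally have "(s - 1) * (LINT x|lborel. f2 x) + (\<gamma> - 1) / R powr (s - 1) * (LINT x|lborel. f3 x)
        \<le> (LINT x|lborel. f1 x)"
      using int2 int3 by simp
    moreover have "f1 x = 0" "f2 x = 0" "f3 x = 0" if "x \<notin> \<Omega>" for x
    proof -
      have "x \<notin> K" using that K(2) by blast
      then show "f1 x = 0" "f2 x = 0" "f3 x = 0" by (simp_all add: f1_def f2_def f3_def uK)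
    qed
    ultimately show ?thesis
      using int1 int2 int3 by (simp add: set_lebesgue_integral_eq_lborel borel_measurable_integrable)
  qed
  then show "let d = bdist \<Omega>; R = (SUP x\<in>\<Omega>. bdist \<Omega> x) in
      (LINT x:\<Omega>|lebesgue. norm (grad u x) / d x powr (s - 1))
      \<ge> (s - 1) * (LINT x:\<Omega>|lebesgue. \<bar>u x\<bar> / d x powr s)
        + (\<gamma> - 1) / R powr (s - 1) * (LINT x:\<Omega>|lebesgue. \<bar>u x\<bar> / d x * Xf (d x / R) powr \<gamma>)"
    by (simp only: Let_def f1_def f2_def f3_def d_def R_def)
qed

end
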